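(* Consider environments $e$ in some set, and for each $e$ a joint distribution $P^e$ of $(X_S,X_U,Y)$ on $\mathcal X_S\times\mathcal X_U\times\{0,1\}$. Assume: (1) $X_S$ is stable: there is a measurable $f_S:\mathcal X_S\to[0,1]$ with $P^e[Y=1\mid X_S]=f_S(X_S)$, $P^e$-almost surely, for every $e$; (2) $X_S$ and $X_U$ are complementary: under each $P^e$, $X_S$ and $X_U$ are conditionally independent given $Y$; (3) $X_S$ is informative of $Y$ in the test environment, whose distribution is denoted $P$: under $P$, $X_S$ and $Y$ are not independent. Let $(X_{S,i},X_{U,i})$, $i=1,2,\dots$, be i.i.d. unlabeled samples from the $(X_S,X_U)$-marginal of $P$. For each $n$ let $\tilde f_{U,n}:\mathcal X_U\to[0,1]$ be an estimator (a random function) and define $$n_1=\sum_{i=1}^n f_S(X_{S,i}),\qquad \hat\epsilon_{0,n}=\frac{1}{n-n_1}\sum_{i=1}^n(1-f_S(X_{S,i}))^2,\qquad \hat\epsilon_{1,n}=\frac1{n_1}\sum_{i=1}^n f_S(X_{S,i})^2,$$ $$\hat f_{U,n}(x_U)=\max\Big\{0,\min\Big\{1,\frac{\tilde f_{U,n}(x_U)+\hat\epsilon_{0,n}-1}{\hat\epsilon_{0,n}+\hat\epsilon_{1,n}-1}\Big\}\Big\},$$ $$\hat\eta_n(x_S,x_U)=\sigma\Big(\operatorname{logit}(f_S(x_S))+\operatorname{logit}(\hat f_{U,n}(x_U))-\operatorname{logit}(n_1/n)\Big),\qquad \hat h_n(x_S,x_U)=\mathbf 1\{\hat\eta_n(x_S,x_U)>1/2\}.$$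 Let $\tilde\eta_U(x_U)=\Pr[\hat Y=1\mid X_U=x_U]$ under $P$, where $\hat Y\mid X_S\sim\operatorname{Bernoulli}(f_S(X_S))$ is drawn from $X_S$ alone (so $\tilde\eta_U(X_U)=\mathbb E_P[f_S(X_S)\mid X_U]$), let $\eta(x_S,x_U)=P[Y=1\mid X_S=x_S,X_U=x_U]$, and $h^*=\mathbf 1\{\eta>1/2\}$. Then, as $n\to\infty$: (a) if for $P_{X_U}$-almost all $x_U$, $\tilde f_{U,n}(x_U)\to\tilde\eta_U(x_U)$ in probability, then for $P_{X_S,X_U}$-almost all $(x_S,x_U)$, $\hat\eta_n(x_S,x_U)\to\eta(x_S,x_U)$ in probability, and $R(\hat h_n)\to R(h^* )$ in probability; (b) if for $P_{X_U}$-almost all $x_U$, $\tilde f_{U,n}(x_U)\to\tilde\eta_U(x_U)$ almost surely, then for $P_{X_S,X_U}$-almost all $(x_S,x_U)$, $\hat\eta_n(x_S,x_U)\to\eta(x_S,x_U)$ almost surely, and $R(\hat h_n)\to R(h^* )$ almost surely.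
   Context: $\mathcal X_S,\mathcal X_U$ are standard Borel spaces; $\sigma(t)=1/(1+e^{-t})$, $\operatorname{logit}(p)=\log\frac p{1-p}$ with $\operatorname{logit}(0)=-\infty$, $\operatorname{logit}(1)=+\infty$, $\sigma(\pm\infty)\in\{1,0\}$ accordingly; undefined expressions (zero denominators, $\infty-\infty$) may be assigned any fixed value in $[0,1]$. For a classifier $h:\mathcal X_S\times\mathcal X_U\to\{0,1\}$, $R(h)=P[h(X_S,X_U)\ne Y]$ is its misclassification risk in the test environment; for the data-dependent $\hat h_n$, $R(\hat h_n)$ is the random variable obtained by evaluating $R$ at the realized function $\hat h_n$ (i.e. the test triple is independent of the samples and estimators). The random functions $\tilde f_{U,n}$ are jointly measurable in the randomness and $x_U$; probability and almost-sure convergence refer to the randomness of the samples and estimators. $P_{X_U}$ and $P_{X_S,X_U}$ are marginals of $P$. *)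

theory Defs
  imports "HOL-Probability.Probability"
begin

section \<open>Standard Borel spaces, conditional probabilities, convergence in probability\<close>

definition standard_borel :: "'a measure \<Rightarrow> bool" where
  "standard_borel M \<longleftrightarrow>
     (\<exists>X. topspace X = space M \<and> completely_metrizable_space X \<and> second_countable X \<and>
          sets M = sigma_sets (topspace X) {U. openin X U})"

text \<open>
  \<open>cond_prob_version M X N A g\<close>: the function \<open>g\<close> on the value space \<open>N\<close> of \<open>X\<close> is a version of
  \<open>x \<mapsto> Pr[A | X = x]\<close>, i.e. \<open>g(X)\<close> is almost surely the conditional expectation of the
  indicator of \<open>A\<close> given the sigma-algebra generated by \<open>X\<close>.
\<close>

definition cond_prob_version ::
    "'a measure \<Rightarrow> ('a \<Rightarrow> 'b) \<Rightarrow> 'b measure \<Rightarrow> ('a \<Rightarrow> bool) \<Rightarrow> ('b \<Rightarrow> real) \<Rightarrow> bool" where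
  "cond_prob_version M X N A g \<longleftrightarrow>
     g \<in> borel_measurable N \<and>
     (AE z in M. real_cond_exp M (vimage_algebra (space M) X N)
                   (indicator {z \<in> space M. A z}) z = g (X z))"

text \<open>
  Conditional independence given a discrete variable \<open>Y\<close>. Values \<open>y\<close> of probability zero impose
  no condition, since \<^const>\<open>cond_prob\<close> is then 0 on both sides.
\<close>

definition cond_indep_given ::
    "'a measure \<Rightarrow> 'b measure \<Rightarrow> ('a \<Rightarrow> 'b) \<Rightarrow> 'c measure \<Rightarrow> ('a \<Rightarrow> 'c) \<Rightarrow> ('a \<Rightarrow> 'y) \<Rightarrow> bool" where
  "cond_indep_given M N1 X1 N2 X2 Y \<longleftrightarrow>
     (\<forall>A\<in>sets N1. \<forall>B\<in>sets N2. \<forall>y.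
        \<P>(z in M. X1 z \<in> A \<and> X2 z \<in> B \<bar> Y z = y) =
        \<P>(z in M. X1 z \<in> A \<bar> Y z = y) * \<P>(z in M. X2 z \<in> B \<bar> Y z = y))"

definition tendsto_in_prob :: "'a measure \<Rightarrow> (nat \<Rightarrow> 'a \<Rightarrow> real) \<Rightarrow> real \<Rightarrow> bool" where
  "tendsto_in_prob M Z c \<longleftrightarrow>
     (\<forall>n. Z n \<in> borel_measurable M) \<and>
     (\<forall>e>0. (\<lambda>n. \<P>(w in M. \<bar>Z n w - c\<bar> > e)) \<longlonglongrightarrow> 0)"

section \<open>The data distribution\<close>

text \<open>Labels in \<open>{0,1}\<close> are Booleans, with \<^const>\<open>True\<close> for 1; a data point is \<open>(x\<^sub>S, x\<^sub>U, y)\<close>.\<close>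

abbreviation label_space :: "bool measure" where
  "label_space \<equiv> count_space UNIV"

abbreviation data_space :: "'s measure \<Rightarrow> 'u measure \<Rightarrow> ('s \<times> 'u \<times> bool) measure" where
  "data_space \<X>\<^sub>S \<X>\<^sub>U \<equiv> \<X>\<^sub>S \<Otimes>\<^sub>M \<X>\<^sub>U \<Otimes>\<^sub>M label_space"

abbreviation feat_S :: "'s \<times> 'u \<times> 'r \<Rightarrow> 's" where
  "feat_S z \<equiv> fst z"

abbreviation feat_U :: "'s \<times> 'u \<times> 'r \<Rightarrow> 'u" where
  "feat_U z \<equiv> fst (snd z)"

abbreviation label :: "'s \<times> 'u \<times> 'r \<Rightarrow> 'r" where
  "label z \<equiv> snd (snd z)"

definition risk :: "('s \<times> 'u \<times> bool) measure \<Rightarrow> ('s \<Rightarrow> 'u \<Rightarrow> bool) \<Rightarrow> real" where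
  "risk P h = \<P>(z in P. h (feat_S z) (feat_U z) \<noteq> label z)"

text \<open>
  Joint law of \<open>(X\<^sub>S, X\<^sub>U, Y, Yhat)\<close>, where \<open>(X\<^sub>S, X\<^sub>U, Y)\<close> has law \<open>P\<close> and the pseudo-label
  \<open>Yhat\<close> is drawn from \<open>Bernoulli(f\<^sub>S(X\<^sub>S))\<close> using \<open>X\<^sub>S\<close> alone.
\<close>

definition pseudo_label_law ::
    "'s measure \<Rightarrow> 'u measure \<Rightarrow> ('s \<times> 'u \<times> bool) measure \<Rightarrow> ('s \<Rightarrow> real)
      \<Rightarrow> ('s \<times> 'u \<times> bool \<times> bool) measure" where
  "pseudo_label_law \<X>\<^sub>S \<X>\<^sub>U P fS =
     P \<bind> (\<lambda>(s, u, y). distr (measure_pmf (bernoulli_pmf (fS s)))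
                          (\<X>\<^sub>S \<Otimes>\<^sub>M \<X>\<^sub>U \<Otimes>\<^sub>M label_space \<Otimes>\<^sub>M label_space)
                          (\<lambda>yhat. (s, u, y, yhat)))"

section \<open>The estimators\<close>

definition logit :: "real \<Rightarrow> ereal" where
  "logit p = (if p = 0 then - \<infinity> else if p = 1 then \<infinity> else ereal (ln (p / (1 - p))))"

definition sigmoid :: "ereal \<Rightarrow> real" where
  "sigmoid x = (if x = \<infinity> then 1 else if x = - \<infinity> then 0
                else 1 / (1 + exp (- real_of_ereal x)))"

text \<open>
  Expressions that are undefined on paper receive an explicit value \<open>c\<close> rather than the
  library's default (\<open>x / 0 = 0\<close> on reals, \<open>\<infinity> - \<infinity> = \<infinity>\<close> on extended reals).
\<close>

definition div_or :: "real \<Rightarrow> real \<Rightarrow> real \<Rightarrow> real" where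
  "div_or c a b = (if b = 0 then c else a / b)"

definition sigmoid_sum_or :: "real \<Rightarrow> ereal \<Rightarrow> ereal \<Rightarrow> ereal \<Rightarrow> real" where
  "sigmoid_sum_or c a b d =
     (if \<infinity> \<in> {a, b, d} \<and> - \<infinity> \<in> {a, b, d} then c else sigmoid (a + b + d))"

text \<open>
  In what follows \<open>xs i\<close> (for \<open>i = 1, 2, \<dots>\<close>) is the realized stable feature of sample \<open>i\<close>, \<open>ft\<close>
  is the realized estimate of the pseudo-label probability, and \<open>c0\<close>, \<open>c1\<close>, \<open>cf\<close>, \<open>ce\<close>
  are the values assigned to undefined expressions.
\<close>

definition n_one :: "('s \<Rightarrow> real) \<Rightarrow> (nat \<Rightarrow> 's) \<Rightarrow> nat \<Rightarrow> real" where
  "n_one fS xs n = (\<Sum>i=1..n. fS (xs i))"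

definition eps0_hat :: "real \<Rightarrow> ('s \<Rightarrow> real) \<Rightarrow> (nat \<Rightarrow> 's) \<Rightarrow> nat \<Rightarrow> real" where
  "eps0_hat c0 fS xs n = div_or c0 (\<Sum>i=1..n. (1 - fS (xs i))\<^sup>2) (real n - n_one fS xs n)"

definition eps1_hat :: "real \<Rightarrow> ('s \<Rightarrow> real) \<Rightarrow> (nat \<Rightarrow> 's) \<Rightarrow> nat \<Rightarrow> real" where
  "eps1_hat c1 fS xs n = div_or c1 (\<Sum>i=1..n. (fS (xs i))\<^sup>2) (n_one fS xs n)"

definition fU_hat ::
    "real \<Rightarrow> real \<Rightarrow> real \<Rightarrow> ('s \<Rightarrow> real) \<Rightarrow> (nat \<Rightarrow> 's) \<Rightarrow> nat \<Rightarrow> ('u \<Rightarrow> real) \<Rightarrow> 'u \<Rightarrow> real" where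
  "fU_hat c0 c1 cf fS xs n ft u =
     max 0 (min 1 (div_or cf (ft u + eps0_hat c0 fS xs n - 1)
                             (eps0_hat c0 fS xs n + eps1_hat c1 fS xs n - 1)))"

definition eta_hat ::
    "real \<Rightarrow> real \<Rightarrow> real \<Rightarrow> real \<Rightarrow> ('s \<Rightarrow> real) \<Rightarrow> (nat \<Rightarrow> 's) \<Rightarrow> nat \<Rightarrow> ('u \<Rightarrow> real)
      \<Rightarrow> 's \<Rightarrow> 'u \<Rightarrow> real" where
  "eta_hat c0 c1 cf ce fS xs n ft s u =
     sigmoid_sum_or ce (logit (fS s)) (logit (fU_hat c0 c1 cf fS xs n ft u))
                       (- logit (n_one fS xs n / real n))"

definition h_hat ::
    "real \<Rightarrow> real \<Rightarrow> real \<Rightarrow> real \<Rightarrow> ('s \<Rightarrow> real) \<Rightarrow> (nat \<Rightarrow> 's) \<Rightarrow> nat \<Rightarrow> ('u \<Rightarrow> real)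
      \<Rightarrow> 's \<Rightarrow> 'u \<Rightarrow> bool" where
  "h_hat c0 c1 cf ce fS xs n ft s u \<longleftrightarrow> eta_hat c0 c1 cf ce fS xs n ft s u > 1/2"

end

theory Submission
  imports Defs
begin

text \<open>
  Write \<open>q = P[Y = 1]\<close> and \<open>m = E[f\<^sub>S(X\<^sub>S)\<^sup>2]\<close>. Dependence of \<open>X\<^sub>S\<close> and \<open>Y\<close> forces \<open>Var f\<^sub>S(X\<^sub>S) = m - q\<^sup>2 > 0\<close>, hence
  \<open>0 < q < 1\<close> and \<open>\<epsilon>\<^sub>0 + \<epsilon>\<^sub>1 - 1 = (m - q\<^sup>2) / (q (1 - q)) > 0\<close> for the pseudo-label accuracies
  \<open>\<epsilon>\<^sub>0 = (1 - 2 q + m) / (1 - q)\<close> and \<open>\<epsilon>\<^sub>1 = m / q\<close> given \<open>Y = 0\<close> and \<open>Y = 1\<close>. By complementarity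
  \<open>\<eta>tilde = \<epsilon>\<^sub>1 P[Y = 1 | X\<^sub>U] + (1 - \<epsilon>\<^sub>0) P[Y = 0 | X\<^sub>U]\<close>, which can be solved for \<open>P[Y = 1 | X\<^sub>U]\<close>, and
  the joint law of the features given \<open>Y\<close> is a product, which makes the posterior \<open>\<eta>\<close> the explicit
  rational function \<open>f g r / (f g r + (1 - f) (1 - g) (1 - r))\<close> of \<open>f = f\<^sub>S\<close>, \<open>g = P[Y = 1 | X\<^sub>U]\<close> and
  \<open>r = 1 - q\<close>, with a denominator that is almost surely positive. The logit formula for the estimator
  is the same function of the empirical quantities, which depend on the sample only through the
  averages of \<open>f\<^sub>S\<close> and \<open>f\<^sub>S\<^sup>2\<close>. These converge by the law of large numbers (Hoeffding and
  Borel-Cantelli), so continuity gives the pointwise claims. The excess risk is at most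
  \<open>2 E|\<eta>hat - \<eta>|\<close>, which tends to 0 by Fubini and dominated convergence.
\<close>

section \<open>Versions of conditional probabilities\<close>

text \<open>The measure on the left is the law of \<open>X\<close> on the event \<open>A\<close>,
  not normalised. Under a probability measure it stays finite whatever the probability of
  \<open>A\<close>, and densities and products can be computed for it directly.\<close>

lemma emeasure_distr_density_indicator:
  assumes X[measurable]: "X \<in> measurable M N" and A[measurable]: "Measurable.pred M A"
    and B[measurable]: "B \<in> sets N"
  shows "emeasure (distr (density M (indicator {z \<in> space M. A z})) N X) B
    = emeasure M {z \<in> space M. X z \<in> B \<and> A z}"
proof -
  have "emeasure (distr (density M (indicator {z \<in> space M. A z})) N X) B
      = emeasure (density M (indicator {z \<in> space M. A z})) (X -` B \<inter> space M)"
    by (subst emeasure_distr) auto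
  also have "\<dots> = emeasure M {z \<in> space M. X z \<in> B \<and> A z}"
    by (subst emeasure_density) (auto simp: indicator_inter_arith[symmetric] intro!: arg_cong[where f="emeasure M"])
  finally show ?thesis .
qed

text \<open>The sigma-algebra generated by \<open>X\<close> consists of the preimages of sets in
  \<open>N\<close>, and a conditional expectation is characterised by its integrals over these.
  Change of variables moves the integrals to the law of \<open>X\<close>, where all later arguments
  take place.\<close>

lemma (in prob_space) cond_prob_version_iff:
  assumes X[measurable]: "X \<in> measurable M N" and A[measurable]: "Measurable.pred M A"
  shows "cond_prob_version M X N A g \<longleftrightarrow>
     g \<in> borel_measurable N \<and> integrable (distr M N X) g \<and>
     (\<forall>B\<in>sets N. (LINT x:B|distr M N X. g x) = prob {z \<in> space M. X z \<in> B \<and> A z})"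
    (is "_ \<longleftrightarrow> ?rhs")
proof -
  let ?F = "vimage_algebra (space M) X N" and ?A = "{z \<in> space M. A z}"
  have sub: "subalgebra M ?F"
    by (auto simp: subalgebra_def sets_vimage_algebra2 measurable_space[OF X])
  interpret finite_measure_subalgebra M ?F
    by standard (rule sub)
  have sets_F: "sets ?F = {X -` B \<inter> space M |B. B \<in> sets N}"
    using measurable_space[OF X] by (intro sets_vimage_algebra2) auto
  have iA: "integrable M (indicator ?A :: _ \<Rightarrow> real)"
    by (intro integrable_real_indicator) (auto simp: emeasure_eq_measure)
  have iC: "integrable M (real_cond_exp M ?F (indicator ?A))"
    by (rule real_cond_exp_int(1)[OF iA])
  have ind_A: "(LINT z:X -` B \<inter> space M|M. indicator ?A z) = prob {z \<in> space M. X z \<in> B \<and> A z}"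
    if "B \<in> sets N" for B
  proof -
    have "(LINT z:X -` B \<inter> space M|M. indicator ?A z) = (LINT z|M. indicator {z \<in> space M. X z \<in> B \<and> A z} z :: real)"
      unfolding set_lebesgue_integral_def by (intro Bochner_Integration.integral_cong) (auto split: split_indicator)
    also have "\<dots> = prob {z \<in> space M. X z \<in> B \<and> A z}"
      using that by (subst Bochner_Integration.integral_indicator) (auto intro!: arg_cong[where f=prob])
    finally show ?thesis .
  qed
  have pull: "(LINT x:B|distr M N X. g x) = (LINT z:X -` B \<inter> space M|M. g (X z))"
    if g[measurable]: "g \<in> borel_measurable N" and B: "B \<in> sets N" for B
  proof -
    have "(LINT x:B|distr M N X. g x) = (LINT z|M. indicator B (X z) *\<^sub>R g (X z))"
      unfolding set_lebesgue_integral_def using B by (subst integral_distr) auto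
    also have "\<dots> = (LINT z:X -` B \<inter> space M|M. g (X z))"
      unfolding set_lebesgue_integral_def by (intro Bochner_Integration.integral_cong) (auto split: split_indicator)
    finally show ?thesis .
  qed
  have gX: "(\<lambda>z. g (X z)) \<in> borel_measurable ?F" if "g \<in> borel_measurable N"
    using that measurable_space[OF X] by (intro measurable_compose[OF measurable_vimage_algebra1]) auto
  show ?thesis
  proof
    assume L: "cond_prob_version M X N A g"
    then have g[measurable]: "g \<in> borel_measurable N"
      and ae: "AE z in M. real_cond_exp M ?F (indicator ?A) z = g (X z)"
      by (auto simp: cond_prob_version_def)
    have "integrable M (\<lambda>z. g (X z))"
      using iC by (rule integrable_cong_AE_imp) (use ae in auto)
    then have "integrable (distr M N X) g"
      by (simp add: integrable_distr_eq)
    moreover have "(LINT x:B|distr M N X. g x) = prob {z \<in> space M. X z \<in> B \<and> A z}" if B: "B \<in> sets N" for B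
    proof -
      have "(LINT x:B|distr M N X. g x) = (LINT z:X -` B \<inter> space M|M. g (X z))"
        by (rule pull[OF g B])
      also have "\<dots> = (LINT z:X -` B \<inter> space M|M. real_cond_exp M ?F (indicator ?A) z)"
        unfolding set_lebesgue_integral_def
        by (rule integral_cong_AE) (use ae B in auto)
      also have "\<dots> = (LINT z:X -` B \<inter> space M|M. indicator ?A z)"
        using B by (intro real_cond_exp_intA[symmetric] iA) (auto simp: sets_F)
      finally show ?thesis using ind_A[OF B] by simp
    qed
    ultimately show ?rhs using g by blast
  next
    assume ?rhs
    then have g[measurable]: "g \<in> borel_measurable N" and i: "integrable (distr M N X) g"
      and eq: "\<And>B. B \<in> sets N \<Longrightarrow> (LINT x:B|distr M N X. g x) = prob {z \<in> space M. X z \<in> B \<and> A z}"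
      by auto
    have "AE z in M. real_cond_exp M ?F (indicator ?A) z = g (X z)"
    proof (rule real_cond_exp_charact)
      show "(LINT z:C|M. indicator ?A z) = (LINT z:C|M. g (X z))" if C: "C \<in> sets ?F" for C
      proof -
        obtain B where B: "B \<in> sets N" "C = X -` B \<inter> space M"
          using C unfolding sets_F by blast
        show ?thesis unfolding B(2) ind_A[OF B(1)] pull[OF g B(1), symmetric] by (simp add: eq B)
      qed
      show "integrable M (\<lambda>z. g (X z))" using i by (simp add: integrable_distr_eq)
    qed (use iA gX[OF g] in auto)
    then show "cond_prob_version M X N A g"
      by (auto simp: cond_prob_version_def)
  qed
qed

lemma (in prob_space) cond_prob_version_AE_unique:
  assumes X[measurable]: "X \<in> measurable M N" and A[measurable]: "Measurable.pred M A"
    and "cond_prob_version M X N A g" "cond_prob_version M X N A h"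
  shows "AE x in distr M N X. g x = h x"
proof -
  have [measurable]: "g \<in> borel_measurable N" "h \<in> borel_measurable N"
    using assms by (auto simp: cond_prob_version_def)
  have "AE z in M. g (X z) = h (X z)"
    using assms(3,4) unfolding cond_prob_version_def by auto
  then show ?thesis by (subst AE_distr_iff) auto
qed

lemma (in prob_space) cond_prob_version_cong_AE:
  assumes X[measurable]: "X \<in> measurable M N"
    and g: "cond_prob_version M X N A g"
    and h: "h \<in> borel_measurable N" and eq: "AE x in distr M N X. g x = h x"
  shows "cond_prob_version M X N A h"
  using AE_distrD[OF X eq] g h unfolding cond_prob_version_def by auto

text \<open>Conditional expectation is monotone, so the bounds 0 and 1 of the indicator pass to it.
  A version is arbitrary on null sets, hence the bound holds only almost everywhere.\<close>

lemma (in prob_space) cond_prob_version_range: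
  assumes X[measurable]: "X \<in> measurable M N" and A[measurable]: "Measurable.pred M A"
    and g: "cond_prob_version M X N A g"
  shows "AE x in distr M N X. g x \<in> {0..1}"
proof -
  let ?F = "vimage_algebra (space M) X N" and ?A = "{z \<in> space M. A z}"
  have sub: "subalgebra M ?F"
    by (auto simp: subalgebra_def sets_vimage_algebra2 measurable_space[OF X])
  interpret finite_measure_subalgebra M ?F
    by standard (rule sub)
  have [measurable]: "g \<in> borel_measurable N" using g by (auto simp: cond_prob_version_def)
  have iA: "integrable M (indicator ?A :: _ \<Rightarrow> real)"
    by (intro integrable_real_indicator) (auto simp: emeasure_eq_measure)
  have "AE z in M. real_cond_exp M ?F (indicator ?A) z = g (X z)"
    using g by (auto simp: cond_prob_version_def)
  moreover have "AE z in M. real_cond_exp M ?F (indicator ?A) z \<ge> 0"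
    by (rule real_cond_exp_ge_c[OF iA]) auto
  moreover have "AE z in M. real_cond_exp M ?F (indicator ?A) z \<le> 1"
    by (rule real_cond_exp_le_c[OF iA]) (auto split: split_indicator)
  ultimately have "AE z in M. g (X z) \<in> {0..1}" by eventually_elim auto
  then show ?thesis by (subst AE_distr_iff) auto
qed

lemma (in prob_space) cond_prob_version_not:
  assumes X[measurable]: "X \<in> measurable M N" and A[measurable]: "Measurable.pred M A"
    and g: "cond_prob_version M X N A g"
  shows "cond_prob_version M X N (\<lambda>z. \<not> A z) (\<lambda>x. 1 - g x)"
proof -
  interpret D: prob_space "distr M N X" by (rule prob_space_distr) simp
  have g': "g \<in> borel_measurable N" "integrable (distr M N X) g"
    and eq: "\<And>B. B \<in> sets N \<Longrightarrow> (LINT x:B|distr M N X. g x) = prob {z \<in> space M. X z \<in> B \<and> A z}"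
    using g unfolding cond_prob_version_iff[OF X A] by auto
  have "(LINT x:B|distr M N X. 1 - g x) = prob {z \<in> space M. X z \<in> B \<and> \<not> A z}" if B[measurable]: "B \<in> sets N" for B
  proof -
    have "(LINT x:B|distr M N X. 1 - g x) = (LINT x:B|distr M N X. 1) - (LINT x:B|distr M N X. g x)"
      using integrable_mult_indicator[OF _ g'(2), of B] integrable_mult_indicator[OF _ D.integrable_const[of "1::real"], of B] B
      by (intro set_integral_diff) (simp_all add: set_integrable_def)
    also have "(LINT x:B|distr M N X. 1) = prob {z \<in> space M. X z \<in> B}"
      using B by (simp add: set_lebesgue_integral_def measure_distr) (auto intro!: arg_cong[where f=prob])
    also have "prob {z \<in> space M. X z \<in> B} - (LINT x:B|distr M N X. g x) = prob ({z \<in> space M. X z \<in> B} - {z \<in> space M. X z \<in> B \<and> A z})"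
      unfolding eq[OF B] by (subst finite_measure_Diff) auto
    also have "{z \<in> space M. X z \<in> B} - {z \<in> space M. X z \<in> B \<and> A z} = {z \<in> space M. X z \<in> B \<and> \<not> A z}"
      by auto
    finally show ?thesis .
  qed
  then show ?thesis
    by (subst cond_prob_version_iff) (use g' in auto)
qed

text \<open>A conditional probability is the Radon-Nikodym derivative of the law of \<open>X\<close>
  on \<open>A\<close> with respect to the full law of \<open>X\<close>.\<close>

lemma (in prob_space) cond_prob_version_density:
  assumes X[measurable]: "X \<in> measurable M N" and A[measurable]: "Measurable.pred M A"
    and g: "cond_prob_version M X N A g"
  shows "distr (density M (indicator {z \<in> space M. A z})) N X = density (distr M N X) g"
proof (rule measure_eqI)
  fix B assume "B \<in> sets (distr (density M (indicator {z \<in> space M. A z})) N X)"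
  then have B[measurable]: "B \<in> sets N" by simp
  interpret D: prob_space "distr M N X" by (rule prob_space_distr) simp
  have g'[measurable]: "g \<in> borel_measurable N" and i: "integrable (distr M N X) g"
    and eq: "\<And>B. B \<in> sets N \<Longrightarrow> (LINT x:B|distr M N X. g x) = prob {z \<in> space M. X z \<in> B \<and> A z}"
    using g unfolding cond_prob_version_iff[OF X A] by auto
  have nn: "AE x in distr M N X. 0 \<le> g x"
    using cond_prob_version_range[OF X A g] by eventually_elim auto
  have "emeasure (distr (density M (indicator {z \<in> space M. A z})) N X) B = emeasure M {z \<in> space M. X z \<in> B \<and> A z}"
    by (rule emeasure_distr_density_indicator) measurable
  also have "\<dots> = ennreal (LINT x:B|distr M N X. g x)"
    by (simp add: eq emeasure_eq_measure)
  also have "\<dots> = (\<integral>\<^sup>+x. ennreal (indicator B x * g x) \<partial>distr M N X)"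
    unfolding set_lebesgue_integral_def
    by (subst nn_integral_eq_integral) (use nn in \<open>auto intro!: integrable_mult_indicator[where 'b=real, simplified] i elim: eventually_mono\<close>)
  also have "\<dots> = emeasure (density (distr M N X) g) B"
    by (subst emeasure_density) (auto intro!: nn_integral_cong simp: ennreal_mult' split: split_indicator)
  finally show "emeasure (distr (density M (indicator {z \<in> space M. A z})) N X) B = emeasure (density (distr M N X) g) B" .
qed auto

text \<open>Introduction rule in terms of nonnegative integrals, suited to laws given by
  \<open>ennreal\<close> densities. The range assumption supplies integrability and lets the two
  kinds of integral be identified.\<close>

lemma (in prob_space) cond_prob_versionI_nn:
  assumes X[measurable]: "X \<in> measurable M N" and A[measurable]: "Measurable.pred M A"
    and g[measurable]: "g \<in> borel_measurable N" and range: "AE x in distr M N X. g x \<in> {0..1}"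
    and eq: "\<And>B. B \<in> sets N \<Longrightarrow>
      (\<integral>\<^sup>+x\<in>B. ennreal (g x) \<partial>distr M N X) = emeasure M {z \<in> space M. X z \<in> B \<and> A z}"
  shows "cond_prob_version M X N A g"
proof -
  interpret D: prob_space "distr M N X" by (rule prob_space_distr) simp
  have "integrable (distr M N X) g"
    by (rule D.integrable_const_bound[where B=1]) (use range in \<open>auto elim: eventually_mono\<close>)
  moreover have "(LINT x:B|distr M N X. g x) = prob {z \<in> space M. X z \<in> B \<and> A z}" if B[measurable]: "B \<in> sets N" for B
  proof -
    have "(LINT x:B|distr M N X. g x) = enn2real (\<integral>\<^sup>+x. ennreal (indicator B x *\<^sub>R g x) \<partial>distr M N X)"
      unfolding set_lebesgue_integral_def
      by (rule integral_eq_nn_integral) (use range in \<open>auto elim: eventually_mono\<close>)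
    also have "(\<integral>\<^sup>+x. ennreal (indicator B x *\<^sub>R g x) \<partial>distr M N X) = (\<integral>\<^sup>+x\<in>B. ennreal (g x) \<partial>distr M N X)"
      by (intro nn_integral_cong) (auto split: split_indicator)
    finally show ?thesis by (simp add: eq measure_def)
  qed
  ultimately show ?thesis by (subst cond_prob_version_iff) auto
qed

text \<open>\<open>cond_prob_version_density\<close> read against a test function: next to a
  function of \<open>X\<close>, the indicator of \<open>A\<close> may be exchanged for
  \<open>g\<close>.\<close>

lemma (in prob_space) cond_prob_version_integral:
  assumes X[measurable]: "X \<in> measurable M N" and A[measurable]: "Measurable.pred M A"
    and g: "cond_prob_version M X N A g"
    and h[measurable]: "h \<in> borel_measurable N"
  shows "(\<integral>z. h (X z) * indicator {z \<in> space M. A z} z \<partial>M) = (\<integral>z. h (X z) * g (X z) \<partial>M)"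
proof -
  let ?I = "indicator {z \<in> space M. A z} :: _ \<Rightarrow> real"
  have [measurable]: "g \<in> borel_measurable N" using g by (auto simp: cond_prob_version_def)
  have "(\<integral>z. h (X z) * ?I z \<partial>M) = (\<integral>z. h (X z) \<partial>density M ?I)"
    by (subst integral_density) (auto simp: mult.commute)
  \<comment> \<open>The indicator \<open>?I\<close> is real-valued and coerced to
    \<open>ennreal\<close>, as \<open>integral_density\<close> wants it; the other one is
    \<open>ennreal\<close>-valued, as in \<open>cond_prob_version_density\<close>.\<close>
  also have "density M ?I = density M (indicator {z \<in> space M. A z})"
    by (intro arg_cong[where f="density M"] ext) (auto split: split_indicator)
  also have "(\<integral>z. h (X z) \<partial>density M (indicator {z \<in> space M. A z})) =
      (\<integral>x. h x \<partial>distr (density M (indicator {z \<in> space M. A z})) N X)"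
    by (subst integral_distr) auto
  also have "\<dots> = (\<integral>x. h x \<partial>density (distr M N X) g)"
    by (simp add: cond_prob_version_density[OF X A g])
  also have "\<dots> = (\<integral>x. g x * h x \<partial>distr M N X)"
    using cond_prob_version_range[OF X A g] by (subst integral_density) (auto elim: eventually_mono)
  also have "\<dots> = (\<integral>z. h (X z) * g (X z) \<partial>M)"
    by (subst integral_distr) (auto simp: mult.commute)
  finally show ?thesis .
qed

section \<open>Complementary features\<close>

text \<open>
  The posterior of \<open>Y = 1\<close> for \<open>f = P[Y = 1 | X\<^sub>S]\<close>, \<open>g = P[Y = 1 | X\<^sub>U]\<close> and \<open>r = P[Y = 0]\<close>. Taking the
  probability of \<open>Y = 0\<close> makes it symmetric in its arguments, since \<open>- logit q = logit (1 - q)\<close>.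
\<close>

definition bayes :: "real \<Rightarrow> real \<Rightarrow> real \<Rightarrow> real" where
  "bayes f g r = f * g * r / (f * g * r + (1 - f) * (1 - g) * (1 - r))"

text \<open>The numerator is one of the two nonnegative summands of the denominator. If the
  denominator is 0, the quotient is 0 by convention.\<close>

lemma bayes_range:
  assumes "f \<in> {0..1}" "g \<in> {0..1}" "r \<in> {0..1}"
  shows "bayes f g r \<in> {0..1}"
proof -
  have "0 \<le> f * g * r" "0 \<le> (1 - f) * (1 - g) * (1 - r)" using assms by auto
  then show ?thesis by (auto simp: bayes_def divide_simps)
qed

text \<open>A product measure is determined by its values on rectangles, where conditional
  independence says \<open>K (A x B) = K A * K B / q\<close> with \<open>q\<close> the total mass of
  \<open>K\<close>. Since \<open>K\<close> is not normalised, one of the two marginals has to be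
  divided by \<open>q\<close>.\<close>

lemma (in prob_space) cond_indep_joint_law:
  fixes y :: "'y"
  assumes X1[measurable]: "X1 \<in> measurable M N1" and X2[measurable]: "X2 \<in> measurable M N2"
    and Y[measurable]: "Y \<in> measurable M (count_space UNIV)"
    and indep: "cond_indep_given M N1 X1 N2 X2 Y"
    and pos: "prob {z \<in> space M. Y z = y} > 0"
  defines "K \<equiv> density M (indicator {z \<in> space M. Y z = y})"
  shows "density (distr K N1 X1) (\<lambda>_. ennreal (1 / prob {z \<in> space M. Y z = y})) \<Otimes>\<^sub>M distr K N2 X2
       = distr K (N1 \<Otimes>\<^sub>M N2) (\<lambda>z. (X1 z, X2 z))"
proof -
  let ?q = "prob {z \<in> space M. Y z = y}"
  have sK[measurable_cong, simp]: "sets K = sets M" "space K = space M"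
    by (simp_all add: K_def)
  have eK: "emeasure (distr K L X) C = ennreal (prob {z \<in> space M. X z \<in> C \<and> Y z = y})"
    if X[measurable]: "X \<in> measurable M L" and C[measurable]: "C \<in> sets L" for L :: "'l measure" and X C
    unfolding K_def
    by (subst emeasure_distr_density_indicator) (simp_all add: emeasure_eq_measure)
  have fK: "finite_measure (distr K L X)" if "X \<in> measurable M L" for L :: "'l measure" and X
    using that eK[OF that sets.top] by (intro finite_measureI) simp
  have fK': "finite_measure (density (distr K N1 X1) (\<lambda>_. ennreal (1 / ?q)))"
  proof (rule finite_measureI)
    interpret finite_measure "distr K N1 X1" by (rule fK) simp
    show "emeasure (density (distr K N1 X1) (\<lambda>_. ennreal (1 / ?q))) (space (density (distr K N1 X1) (\<lambda>_. ennreal (1 / ?q)))) \<noteq> \<infinity>"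
      using emeasure_finite[of "space N1"] by (simp add: emeasure_density_const ennreal_mult_eq_top_iff del: emeasure_distr)
  qed
  show ?thesis
  proof (rule pair_measure_eqI)
    fix A B assume A: "A \<in> sets (density (distr K N1 X1) (\<lambda>_. ennreal (1 / ?q)))" and B: "B \<in> sets (distr K N2 X2)"
    then have [measurable]: "A \<in> sets N1" "B \<in> sets N2" by simp_all
    have "prob {z \<in> space M. X1 z \<in> A \<and> X2 z \<in> B \<and> Y z = y} / ?q =
        prob {z \<in> space M. X1 z \<in> A \<and> Y z = y} / ?q * (prob {z \<in> space M. X2 z \<in> B \<and> Y z = y} / ?q)"
      using indep \<open>A \<in> sets N1\<close> \<open>B \<in> sets N2\<close> unfolding cond_indep_given_def cond_prob_def
      by (auto simp: conj_assoc)
    then have eq: "prob {z \<in> space M. X1 z \<in> A \<and> X2 z \<in> B \<and> Y z = y} =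
        1 / ?q * prob {z \<in> space M. X1 z \<in> A \<and> Y z = y} * prob {z \<in> space M. X2 z \<in> B \<and> Y z = y}"
      using pos by (simp add: field_simps)
    have "emeasure (density (distr K N1 X1) (\<lambda>_. ennreal (1 / ?q))) A
        = ennreal (1 / ?q * prob {z \<in> space M. X1 z \<in> A \<and> Y z = y})"
      by (simp add: emeasure_density_const eK ennreal_mult'[symmetric])
    then show "emeasure (density (distr K N1 X1) (\<lambda>_. ennreal (1 / ?q))) A * emeasure (distr K N2 X2) B
        = emeasure (distr K (N1 \<Otimes>\<^sub>M N2) (\<lambda>z. (X1 z, X2 z))) (A \<times> B)"
      by (simp add: eK eq ennreal_mult'[symmetric] conj_assoc)
  qed (auto intro!: finite_measure.sigma_finite_measure fK fK' cong: sets_pair_measure_cong)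
qed

text \<open>Each marginal of the law on \<open>Y = y\<close> has the conditional probability as its
  density, so the product from \<open>cond_indep_joint_law\<close> has the product density over the
  independent coupling of \<open>X1\<close> and \<open>X2\<close>. This puts the laws for different
  \<open>y\<close> on one reference measure.\<close>

lemma (in prob_space) cond_indep_joint_density:
  fixes y :: "'y"
  assumes X1[measurable]: "X1 \<in> measurable M N1" and X2[measurable]: "X2 \<in> measurable M N2"
    and Y[measurable]: "Y \<in> measurable M (count_space UNIV)"
    and indep: "cond_indep_given M N1 X1 N2 X2 Y"
    and pos: "prob {z \<in> space M. Y z = y} > 0"
    and f: "cond_prob_version M X1 N1 (\<lambda>z. Y z = y) f" "\<And>x. x \<in> space N1 \<Longrightarrow> 0 \<le> f x"
    and g: "cond_prob_version M X2 N2 (\<lambda>z. Y z = y) g"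
  shows "distr (density M (indicator {z \<in> space M. Y z = y})) (N1 \<Otimes>\<^sub>M N2) (\<lambda>z. (X1 z, X2 z))
       = density (distr M N1 X1 \<Otimes>\<^sub>M distr M N2 X2)
           (\<lambda>(s, u). ennreal (f s * g u / prob {z \<in> space M. Y z = y}))"
proof -
  let ?q = "prob {z \<in> space M. Y z = y}"
  have [measurable]: "f \<in> borel_measurable N1" "g \<in> borel_measurable N2"
    using f g by (auto simp: cond_prob_version_def)
  interpret D1: prob_space "distr M N1 X1" by (rule prob_space_distr) simp
  interpret D2: prob_space "distr M N2 X2" by (rule prob_space_distr) simp
  \<comment> \<open>\<open>pair_measure_density\<close> asks for sigma-finiteness of the second
    factor, which is visible once it is recognised as the law of \<open>X2\<close> on an
    event.\<close>
  have fin: "finite_measure (density (distr M N2 X2) (\<lambda>x. ennreal (g x)))"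
  proof (subst cond_prob_version_density[OF X2 _ g, symmetric])
    show "finite_measure (distr (density M (indicator {z \<in> space M. Y z = y})) N2 X2)"
      by (intro finite_measure.finite_measure_distr finite_measure_restricted) auto
  qed simp
  have "distr (density M (indicator {z \<in> space M. Y z = y})) (N1 \<Otimes>\<^sub>M N2) (\<lambda>z. (X1 z, X2 z))
     = density (density (distr M N1 X1) f) (\<lambda>_. ennreal (1 / ?q)) \<Otimes>\<^sub>M density (distr M N2 X2) g"
    unfolding cond_indep_joint_law[OF X1 X2 Y indep pos, symmetric]
    by (simp add: cond_prob_version_density[OF X1 _ f(1)] cond_prob_version_density[OF X2 _ g])
  also have "density (density (distr M N1 X1) f) (\<lambda>_. ennreal (1 / ?q))
      = density (distr M N1 X1) (\<lambda>x. ennreal (f x) * ennreal (1 / ?q))"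
    by (subst density_density_eq) auto
  also have "\<dots> = density (distr M N1 X1) (\<lambda>x. ennreal (f x / ?q))"
    using pos f(2) by (intro density_cong) (auto simp: ennreal_mult[symmetric])
  also have "\<dots> \<Otimes>\<^sub>M density (distr M N2 X2) g
      = density (distr M N1 X1 \<Otimes>\<^sub>M distr M N2 X2) (\<lambda>(x, y). ennreal (f x / ?q) * ennreal (g y))"
    by (rule pair_measure_density)
       (auto intro!: D2.sigma_finite_measure_axioms finite_measure.sigma_finite_measure fin)
  also have "\<dots> = density (distr M N1 X1 \<Otimes>\<^sub>M distr M N2 X2) (\<lambda>(s, u). ennreal (f s * g u / ?q))"
    using pos f(2) by (intro density_cong) (auto simp: space_pair_measure ennreal_mult'[symmetric])
  finally show ?thesis .
qed

text \<open>The posterior times the total density of the features is the density on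
  \<open>Y = 1\<close>. If the denominator of \<open>bayes\<close> vanishes, both nonnegative
  summands do, and the two sides are 0.\<close>

lemma bayes_mult:
  assumes "f \<in> {0..1}" "g \<in> {0..1}" "q \<in> {0<..<1}"
  shows "bayes f g (1 - q) * (f * g / q + (1 - f) * (1 - g) / (1 - q)) = f * g / q"
proof -
  have nn: "0 \<le> f * g * (1 - q)" "0 \<le> (1 - f) * (1 - g) * q" using assms by auto
  have w: "f * g / q + (1 - f) * (1 - g) / (1 - q) = (f * g * (1 - q) + (1 - f) * (1 - g) * q) / (q * (1 - q))"
    using assms by (simp add: add_divide_eq_iff divide_add_eq_iff field_simps)
  show ?thesis
  proof (cases "f * g * (1 - q) + (1 - f) * (1 - g) * q = 0")
    case True
    with nn have "f * g * (1 - q) = 0" by linarith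
    then show ?thesis using assms by (auto simp: bayes_def)
  next
    case False
    then show ?thesis unfolding w bayes_def using assms by simp
  qed
qed

text \<open>Bayes' rule: over the product of the marginals, the law of the pair has density
  \<open>w1 + w0\<close>, split according to \<open>Y\<close>, and the posterior is
  \<open>w1 / (w1 + w0)\<close>. The law of the pair does not charge the set where its own density
  vanishes, which gives the second claim.\<close>

lemma (in prob_space) cond_indep_posterior:
  fixes Y :: "'a \<Rightarrow> bool"
  assumes X1[measurable]: "X1 \<in> measurable M N1" and X2[measurable]: "X2 \<in> measurable M N2"
    and Y[measurable]: "Y \<in> measurable M (count_space UNIV)"
    and indep: "cond_indep_given M N1 X1 N2 X2 Y"
    and q: "prob {z \<in> space M. Y z} \<in> {0<..<1}"
    and f: "cond_prob_version M X1 N1 Y f" and f01: "\<And>x. x \<in> space N1 \<Longrightarrow> f x \<in> {0..1}"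
    and g: "cond_prob_version M X2 N2 Y g" and g01: "\<And>x. x \<in> space N2 \<Longrightarrow> g x \<in> {0..1}"
  defines "r \<equiv> prob {z \<in> space M. \<not> Y z}"
  shows "cond_prob_version M (\<lambda>z. (X1 z, X2 z)) (N1 \<Otimes>\<^sub>M N2) Y (\<lambda>(s, u). bayes (f s) (g u) r)" (is ?ver)
    and "AE (s, u) in distr M (N1 \<Otimes>\<^sub>M N2) (\<lambda>z. (X1 z, X2 z)).
           f s * g u * r + (1 - f s) * (1 - g u) * (1 - r) > 0" (is ?pos)
proof -
  define q where "q = prob {z \<in> space M. Y z}"
  have r: "r = 1 - q" unfolding r_def q_def by (subst prob_neg) auto
  have q01: "q \<in> {0<..<1}" using q by (simp add: q_def)
  have [measurable]: "f \<in> borel_measurable N1" "g \<in> borel_measurable N2"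
    using f g by (auto simp: cond_prob_version_def)
  let ?X = "\<lambda>z. (X1 z, X2 z)" and ?N = "N1 \<Otimes>\<^sub>M N2"
  let ?D = "distr M ?N ?X" and ?\<Pi> = "distr M N1 X1 \<Otimes>\<^sub>M distr M N2 X2"
  let ?K = "\<lambda>y. distr (density M (indicator {z \<in> space M. Y z = y})) ?N ?X"
  \<comment> \<open>\<open>w1\<close> and \<open>w0\<close> are the densities of the law of the pair
    on \<open>Y = 1\<close> and on \<open>Y = 0\<close> with respect to
    \<open>?\<Pi>\<close>.\<close>
  define w1 where "w1 = (\<lambda>(s, u). f s * g u / q)"
  define w0 where "w0 = (\<lambda>(s, u). (1 - f s) * (1 - g u) / (1 - q))"
  have [measurable]: "w1 \<in> borel_measurable ?N" "w0 \<in> borel_measurable ?N"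
    unfolding w1_def w0_def by measurable
  have nn: "0 \<le> w1 p" "0 \<le> w0 p" if "p \<in> space ?N" for p
    using that f01 g01 q01 by (auto simp: w1_def w0_def space_pair_measure)
  have K1: "?K True = density ?\<Pi> w1"
    using cond_indep_joint_density[OF X1 X2 Y indep, of True f g] f g f01 q01
    by (simp add: q_def w1_def split_def)
  have K0: "?K False = density ?\<Pi> w0"
    using cond_indep_joint_density[OF X1 X2 Y indep, of False "\<lambda>x. 1 - f x" "\<lambda>x. 1 - g x"]
      cond_prob_version_not[OF X1 _ f] cond_prob_version_not[OF X2 _ g] f01 q01 r
    by (simp add: q_def r_def w0_def split_def)
  have eK: "emeasure (?K y) C = emeasure M {z \<in> space M. ?X z \<in> C \<and> Y z = y}" if [measurable]: "C \<in> sets ?N" for y C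
    by (rule emeasure_distr_density_indicator) measurable
  have D: "?D = density ?\<Pi> (\<lambda>p. ennreal (w1 p) + ennreal (w0 p))"
  proof (rule measure_eqI)
    fix C assume "C \<in> sets ?D"
    then have C[measurable]: "C \<in> sets ?N" by simp
    have "emeasure ?D C = emeasure M ({z \<in> space M. ?X z \<in> C \<and> Y z = True} \<union> {z \<in> space M. ?X z \<in> C \<and> Y z = False})"
      by (subst emeasure_distr) (auto intro!: arg_cong[where f="emeasure M"])
    also have "\<dots> = emeasure (?K True) C + emeasure (?K False) C"
      unfolding eK[OF C] by (intro plus_emeasure[symmetric]) auto
    also have "\<dots> = emeasure (density ?\<Pi> (\<lambda>p. ennreal (w1 p) + ennreal (w0 p))) C"
      unfolding K1 K0 by (simp add: emeasure_density nn_integral_add[symmetric] distrib_right)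
    finally show "emeasure ?D C = emeasure (density ?\<Pi> (\<lambda>p. ennreal (w1 p) + ennreal (w0 p))) C" .
  qed (simp cong: sets_pair_measure_cong)
  let ?b = "\<lambda>(s, u). bayes (f s) (g u) r"
  have b01: "?b p \<in> {0..1}" if "p \<in> space ?N" for p
    using that f01 g01 q01 bayes_range[of "f (fst p)" "g (snd p)" r]
    by (cases p) (simp add: space_pair_measure r)
  have bm[measurable]: "?b \<in> borel_measurable ?N"
    unfolding bayes_def by measurable
  have bw: "?b p * (w1 p + w0 p) = w1 p" if "p \<in> space ?N" for p
    using that f01 g01 q01 unfolding w1_def w0_def r
    by (auto simp: space_pair_measure simp del: atLeastAtMost_iff greaterThanLessThan_iff intro!: bayes_mult)
  show ?ver
  proof (rule cond_prob_versionI_nn)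
    show "AE p in ?D. ?b p \<in> {0..1}"
      using b01 by (intro AE_I2) (simp del: atLeastAtMost_iff)
    fix C assume C[measurable]: "C \<in> sets ?N"
    have "(\<integral>\<^sup>+p\<in>C. ennreal (?b p) \<partial>?D) = (\<integral>\<^sup>+p. (ennreal (w1 p) + ennreal (w0 p)) * (ennreal (?b p) * indicator C p) \<partial>?\<Pi>)"
      unfolding D by (subst nn_integral_density) auto
    also have "\<dots> = (\<integral>\<^sup>+p. ennreal (w1 p) * indicator C p \<partial>?\<Pi>)"
    proof (intro nn_integral_cong)
      fix p assume "p \<in> space ?\<Pi>"
      then have p: "p \<in> space ?N" by (simp add: space_pair_measure)
      have "(ennreal (w1 p) + ennreal (w0 p)) * ennreal (?b p) = ennreal (?b p * (w1 p + w0 p))"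
        using b01[OF p] nn[OF p] by (simp add: ennreal_mult' ennreal_plus[symmetric] mult.commute del: ennreal_plus)
      then show "(ennreal (w1 p) + ennreal (w0 p)) * (ennreal (?b p) * indicator C p) = ennreal (w1 p) * indicator C p"
        by (simp add: bw[OF p] mult.assoc[symmetric])
    qed
    also have "\<dots> = emeasure (?K True) C"
      unfolding K1 by (subst emeasure_density) auto
    finally show "(\<integral>\<^sup>+p\<in>C. ennreal (?b p) \<partial>?D) = emeasure M {z \<in> space M. ?X z \<in> C \<and> Y z}"
      unfolding eK[OF C] by simp
  qed auto
  have "AE p in ?D. 0 < w1 p + w0 p"
    unfolding D
  proof (subst AE_density, simp, intro AE_I2 impI)
    fix p assume "p \<in> space ?\<Pi>" "0 < ennreal (w1 p) + ennreal (w0 p)"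
    then show "0 < w1 p + w0 p"
      using nn[of p] by (auto simp: space_pair_measure add_nonneg_pos add_pos_nonneg less_le)
  qed
  then show ?pos
  proof eventually_elim
    case (elim p)
    obtain s u where p: "p = (s, u)" by fastforce
    \<comment> \<open>Clearing the positive factor \<open>q * (1 - q)\<close> turns the density into
      the denominator of \<open>bayes\<close>.\<close>
    have "(w1 p + w0 p) * (q * (1 - q)) = f s * g u * (1 - q) + (1 - f s) * (1 - g u) * q"
      using q01 by (simp add: p w1_def w0_def field_simps)
    moreover have "(w1 p + w0 p) * (q * (1 - q)) > 0" using elim q01 by simp
    ultimately show ?case by (simp add: p r)
  qed
qed

text \<open>On \<open>Y = y\<close> the joint law is a product, so Tonelli splits the integral. The
  factor \<open>1 / ?q\<close> in the product turns the mass of \<open>B\<close> into its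
  conditional probability given \<open>Y = y\<close>.\<close>

lemma (in prob_space) cond_indep_nn_integral:
  fixes y :: "'y"
  assumes X1[measurable]: "X1 \<in> measurable M N1" and X2[measurable]: "X2 \<in> measurable M N2"
    and Y[measurable]: "Y \<in> measurable M (count_space UNIV)"
    and indep: "cond_indep_given M N1 X1 N2 X2 Y"
    and pos: "prob {z \<in> space M. Y z = y} > 0"
    and h[measurable]: "h \<in> borel_measurable N1" and B[measurable]: "B \<in> sets N2"
  shows "(\<integral>\<^sup>+z. h (X1 z) * indicator {z \<in> space M. X2 z \<in> B \<and> Y z = y} z \<partial>M)
       = (\<integral>\<^sup>+z. h (X1 z) * indicator {z \<in> space M. Y z = y} z \<partial>M)
           * ennreal (prob {z \<in> space M. X2 z \<in> B \<and> Y z = y} / prob {z \<in> space M. Y z = y})"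
proof -
  let ?q = "prob {z \<in> space M. Y z = y}" and ?I = "indicator {z \<in> space M. Y z = y} :: 'a \<Rightarrow> ennreal"
  define K where "K = density M ?I"
  let ?K1 = "density (distr K N1 X1) (\<lambda>_. ennreal (1 / ?q))" and ?K2 = "distr K N2 X2"
  have [measurable_cong, simp]: "sets K = sets M" "space K = space M"
    by (simp_all add: K_def)
  interpret K2: finite_measure ?K2
    unfolding K_def by (intro finite_measure.finite_measure_distr finite_measure_restricted) auto
  have K2B: "emeasure ?K2 B = ennreal (prob {z \<in> space M. X2 z \<in> B \<and> Y z = y})"
    unfolding K_def
    by (subst emeasure_distr_density_indicator) (simp_all add: emeasure_eq_measure)
  have "(\<integral>\<^sup>+z. h (X1 z) * indicator {z \<in> space M. X2 z \<in> B \<and> Y z = y} z \<partial>M)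
      = (\<integral>\<^sup>+z. ?I z * (h (X1 z) * indicator B (X2 z)) \<partial>M)"
    by (intro nn_integral_cong) (auto split: split_indicator)
  also have "\<dots> = (\<integral>\<^sup>+z. h (X1 z) * indicator B (X2 z) \<partial>K)"
    unfolding K_def by (subst nn_integral_density) auto
  also have "\<dots> = (\<integral>\<^sup>+p. h (fst p) * indicator B (snd p) \<partial>distr K (N1 \<Otimes>\<^sub>M N2) (\<lambda>z. (X1 z, X2 z)))"
    by (subst nn_integral_distr) auto
  also have "\<dots> = (\<integral>\<^sup>+p. h (fst p) * indicator B (snd p) \<partial>(?K1 \<Otimes>\<^sub>M ?K2))"
    unfolding K_def by (subst cond_indep_joint_law[OF X1 X2 Y indep pos]) simp
  also have "\<dots> = (\<integral>\<^sup>+x. \<integral>\<^sup>+u. h x * indicator B u \<partial>?K2 \<partial>?K1)"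
    by (subst K2.nn_integral_fst[symmetric]) auto
  also have "\<dots> = (\<integral>\<^sup>+x. h x * emeasure ?K2 B \<partial>?K1)"
    by (intro nn_integral_cong nn_integral_cmult_indicator) auto
  also have "\<dots> = (\<integral>\<^sup>+x. h x \<partial>?K1) * emeasure ?K2 B"
    by (subst nn_integral_multc) auto
  also have "(\<integral>\<^sup>+x. h x \<partial>?K1) = ennreal (1 / ?q) * (\<integral>\<^sup>+x. h x \<partial>distr K N1 X1)"
    by (subst nn_integral_density) (auto simp: nn_integral_cmult)
  also have "(\<integral>\<^sup>+x. h x \<partial>distr K N1 X1) = (\<integral>\<^sup>+z. h (X1 z) \<partial>K)"
    by (subst nn_integral_distr) auto
  also have "\<dots> = (\<integral>\<^sup>+z. h (X1 z) * ?I z \<partial>M)"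
    unfolding K_def by (subst nn_integral_density) (auto simp: mult.commute)
  also have "ennreal (1 / ?q) * (\<integral>\<^sup>+z. h (X1 z) * ?I z \<partial>M) * emeasure ?K2 B =
      (\<integral>\<^sup>+z. h (X1 z) * ?I z \<partial>M) * (ennreal (1 / ?q) * emeasure ?K2 B)"
    by (simp add: mult.assoc mult.left_commute)
  also have "ennreal (1 / ?q) * emeasure ?K2 B = ennreal (prob {z \<in> space M. X2 z \<in> B \<and> Y z = y} / ?q)"
    by (simp add: K2B ennreal_mult'[symmetric])
  finally show ?thesis .
qed

text \<open>Splitting by \<open>Y\<close>, the mean of \<open>f (X1 z)\<close> given
  \<open>Y\<close> does not depend on \<open>X2\<close>. It is \<open>m / q\<close> given
  \<open>Y = 1\<close> and \<open>(q - m) / (1 - q)\<close> given \<open>Y = 0\<close>: the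
  probabilities that a pseudo-label is 1 in the two classes.\<close>

lemma (in prob_space) cond_indep_mixture:
  fixes Y :: "'a \<Rightarrow> bool"
  assumes X1[measurable]: "X1 \<in> measurable M N1" and X2[measurable]: "X2 \<in> measurable M N2"
    and Y[measurable]: "Y \<in> measurable M (count_space UNIV)"
    and indep: "cond_indep_given M N1 X1 N2 X2 Y"
    and q: "q = prob {z \<in> space M. Y z}" "q \<in> {0<..<1}"
    and f: "cond_prob_version M X1 N1 Y f" and f01: "\<And>x. x \<in> space N1 \<Longrightarrow> f x \<in> {0..1}"
    and m: "m = expectation (\<lambda>z. (f (X1 z))\<^sup>2)"
    and B[measurable]: "B \<in> sets N2"
  shows "(LINT z:{z \<in> space M. X2 z \<in> B}|M. f (X1 z)) =
    m / q * prob {z \<in> space M. X2 z \<in> B \<and> Y z} + (q - m) / (1 - q) * prob {z \<in> space M. X2 z \<in> B \<and> \<not> Y z}"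
proof -
  have [measurable]: "f \<in> borel_measurable N1" using f by (auto simp: cond_prob_version_def)
  have fX: "f (X1 z) \<in> {0..1}" if "z \<in> space M" for z
    using measurable_space[OF X1 that] f01 by blast
  have int: "integrable M (\<lambda>z. f (X1 z) * indicator C z)" if [measurable]: "C \<in> sets M" for C
    by (rule integrable_const_bound[where B=1]) (use fX in \<open>auto intro!: AE_I2 split: split_indicator\<close>)
  have not_Y: "prob {z \<in> space M. \<not> Y z} = 1 - q"
    unfolding q by (subst prob_neg) auto
  have split: "expectation (\<lambda>z. f (X1 z) * indicator {z \<in> space M. X2 z \<in> B \<and> Y z = y} z)
     = expectation (\<lambda>z. f (X1 z) * indicator {z \<in> space M. Y z = y} z)
         * (prob {z \<in> space M. X2 z \<in> B \<and> Y z = y} / prob {z \<in> space M. Y z = y})" for y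
  proof -
    have pos: "prob {z \<in> space M. Y z = y} > 0"
      using q not_Y by (cases y) auto
    have nn: "(\<integral>\<^sup>+z. ennreal (f (X1 z)) * indicator C z \<partial>M) = ennreal (expectation (\<lambda>z. f (X1 z) * indicator C z))"
      if [measurable]: "C \<in> sets M" for C
    proof (subst nn_integral_eq_integral[symmetric])
      show "(\<integral>\<^sup>+z. ennreal (f (X1 z)) * indicator C z \<partial>M) = (\<integral>\<^sup>+z. ennreal (f (X1 z) * indicator C z) \<partial>M)"
        by (intro nn_integral_cong) (auto split: split_indicator)
    qed (use fX in \<open>auto intro!: AE_I2 int\<close>)
    have nneg: "0 \<le> expectation (\<lambda>z. f (X1 z) * indicator C z)" for C
      using fX by (intro integral_nonneg_AE AE_I2) auto
    have "ennreal (expectation (\<lambda>z. f (X1 z) * indicator {z \<in> space M. X2 z \<in> B \<and> Y z = y} z))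
      = ennreal (expectation (\<lambda>z. f (X1 z) * indicator {z \<in> space M. Y z = y} z)
         * (prob {z \<in> space M. X2 z \<in> B \<and> Y z = y} / prob {z \<in> space M. Y z = y}))"
      using cond_indep_nn_integral[OF X1 X2 Y indep pos, of "\<lambda>s. ennreal (f s)" B] nneg
      by (simp add: nn ennreal_mult' del: times_divide_eq_right)
    then show ?thesis
      by (subst (asm) ennreal_inj) (auto intro!: nneg mult_nonneg_nonneg divide_nonneg_nonneg)
  qed
  \<comment> \<open>The test function is \<open>f\<close> itself: the expectation of
    \<open>f\<close> on \<open>Y = 1\<close> is the second moment of \<open>f\<close>.\<close>
  have EY: "expectation (\<lambda>z. f (X1 z) * indicator {z \<in> space M. Y z} z) = m"
    using cond_prob_version_integral[OF X1 _ f, of f] by (simp add: m power2_eq_square)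
  have Ef: "expectation (\<lambda>z. f (X1 z)) = q"
    using cond_prob_version_integral[OF X1 _ f, of "\<lambda>_. 1"] by (simp add: q)
  have EnY: "expectation (\<lambda>z. f (X1 z) * indicator {z \<in> space M. \<not> Y z} z) = q - m"
  proof -
    have "q = expectation (\<lambda>z. f (X1 z) * indicator {z \<in> space M. Y z} z + f (X1 z) * indicator {z \<in> space M. \<not> Y z} z)"
      unfolding Ef[symmetric] by (intro Bochner_Integration.integral_cong) (auto split: split_indicator)
    also have "\<dots> = m + expectation (\<lambda>z. f (X1 z) * indicator {z \<in> space M. \<not> Y z} z)"
      by (subst Bochner_Integration.integral_add) (auto intro!: int simp: EY)
    finally show ?thesis by simp
  qed
  have "(LINT z:{z \<in> space M. X2 z \<in> B}|M. f (X1 z)) =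
    expectation (\<lambda>z. f (X1 z) * indicator {z \<in> space M. X2 z \<in> B \<and> Y z = True} z
                   + f (X1 z) * indicator {z \<in> space M. X2 z \<in> B \<and> Y z = False} z)"
    unfolding set_lebesgue_integral_def
    by (intro Bochner_Integration.integral_cong) (auto split: split_indicator)
  also have "\<dots> = expectation (\<lambda>z. f (X1 z) * indicator {z \<in> space M. X2 z \<in> B \<and> Y z = True} z)
      + expectation (\<lambda>z. f (X1 z) * indicator {z \<in> space M. X2 z \<in> B \<and> Y z = False} z)"
    by (rule Bochner_Integration.integral_add) (rule int, measurable)+
  also have "\<dots> = m / q * prob {z \<in> space M. X2 z \<in> B \<and> Y z} + (q - m) / (1 - q) * prob {z \<in> space M. X2 z \<in> B \<and> \<not> Y z}"
    unfolding split by (simp add: EY EnY not_Y q(1)[symmetric])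
  finally show ?thesis .
qed

text \<open>\<open>t\<close> is any version of the conditional expectation of
  \<open>f (X1 z)\<close> given \<open>X2\<close>. By \<open>cond_indep_mixture\<close> its integral
  over \<open>B\<close> is \<open>e1\<close> times the mass of \<open>B\<close> with
  \<open>Y = 1\<close> plus \<open>1 - e0\<close> times the mass with \<open>Y = 0\<close>; since
  the two masses add up to that of \<open>B\<close>, the relation can be solved for the
  first.\<close>

lemma (in prob_space) cond_prob_version_from_pseudo_labels:
  fixes Y :: "'a \<Rightarrow> bool"
  assumes X1[measurable]: "X1 \<in> measurable M N1" and X2[measurable]: "X2 \<in> measurable M N2"
    and Y[measurable]: "Y \<in> measurable M (count_space UNIV)"
    and indep: "cond_indep_given M N1 X1 N2 X2 Y"
    and q: "q = prob {z \<in> space M. Y z}" "q \<in> {0<..<1}"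
    and f: "cond_prob_version M X1 N1 Y f" and f01: "\<And>x. x \<in> space N1 \<Longrightarrow> f x \<in> {0..1}"
    and m: "m = expectation (\<lambda>z. (f (X1 z))\<^sup>2)"
    and e: "e0 = (1 - 2 * q + m) / (1 - q)" "e1 = m / q" "e0 + e1 \<noteq> 1"
    and t[measurable]: "t \<in> borel_measurable N2" and ti: "integrable (distr M N2 X2) t"
    and t_eq: "\<And>B. B \<in> sets N2 \<Longrightarrow>
       (LINT u:B|distr M N2 X2. t u) = (LINT z:{z \<in> space M. X2 z \<in> B}|M. f (X1 z))"
  shows "cond_prob_version M X2 N2 Y (\<lambda>u. (t u + e0 - 1) / (e0 + e1 - 1))"
proof -
  interpret D: prob_space "distr M N2 X2" by (rule prob_space_distr) simp
  have "(LINT u:B|distr M N2 X2. (t u + e0 - 1) / (e0 + e1 - 1)) = prob {z \<in> space M. X2 z \<in> B \<and> Y z}"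
    if B[measurable]: "B \<in> sets N2" for B
  proof -
    let ?y = "prob {z \<in> space M. X2 z \<in> B \<and> Y z}" and ?n = "prob {z \<in> space M. X2 z \<in> B \<and> \<not> Y z}"
    have PB: "D.prob B = ?y + ?n"
    proof -
      have "D.prob B = prob ({z \<in> space M. X2 z \<in> B \<and> Y z} \<union> {z \<in> space M. X2 z \<in> B \<and> \<not> Y z})"
        by (subst measure_distr) (auto intro!: arg_cong[where f=prob])
      also have "\<dots> = ?y + ?n" by (intro finite_measure_Union) auto
      finally show ?thesis .
    qed
    have "(LINT u:B|distr M N2 X2. (t u + e0 - 1) / (e0 + e1 - 1))
        = (LINT u|distr M N2 X2. (indicator B u * t u + (e0 - 1) * indicator B u) / (e0 + e1 - 1))"
      unfolding set_lebesgue_integral_def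
      by (intro Bochner_Integration.integral_cong) (auto split: split_indicator)
    also have "\<dots> = ((LINT u:B|distr M N2 X2. t u) + (e0 - 1) * D.prob B) / (e0 + e1 - 1)"
      using integrable_mult_indicator[OF _ ti, of B]
      by (simp add: set_lebesgue_integral_def integrable_real_indicator D.emeasure_eq_measure)
    also have "\<dots> = (e1 * ?y + (1 - e0) * ?n + (e0 - 1) * (?y + ?n)) / (e0 + e1 - 1)"
    proof -
      have "1 - e0 = (q - m) / (1 - q)" using q(2) by (simp add: e field_simps)
      then show ?thesis
        by (simp add: t_eq[OF B] PB e(2) cond_indep_mixture[OF X1 X2 Y indep q f f01 m B])
    qed
    \<comment> \<open>The contributions of \<open>?n\<close> cancel.\<close>
    also have "\<dots> = (e0 + e1 - 1) * ?y / (e0 + e1 - 1)"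
      by (simp add: algebra_simps)
    also have "\<dots> = ?y" using e(3) by simp
    finally show ?thesis .
  qed
  moreover have "integrable (distr M N2 X2) (\<lambda>u. (t u + e0 - 1) / (e0 + e1 - 1))"
    using ti by simp
  ultimately show ?thesis
    by (subst cond_prob_version_iff) auto
qed

text \<open>A constant conditional probability makes the event \<open>Y\<close> independent of every
  event of \<open>X\<close>. A Boolean variable generates only four events, so the remaining ones
  follow by complement or trivially.\<close>

lemma (in prob_space) indep_if_cond_prob_const:
  fixes Y :: "'a \<Rightarrow> bool"
  assumes X[measurable]: "X \<in> measurable M N" and Y[measurable]: "Y \<in> measurable M (count_space UNIV)"
    and f: "cond_prob_version M X N Y f" and const: "AE x in distr M N X. f x = q"
  shows "indep_set (sets (vimage_algebra (space M) X N)) (sets (vimage_algebra (space M) Y (count_space UNIV)))"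
proof -
  have eq: "prob {z \<in> space M. X z \<in> B \<and> Y z} = q * prob {z \<in> space M. X z \<in> B}" if B[measurable]: "B \<in> sets N" for B
  proof -
    have [measurable]: "f \<in> borel_measurable N" using f by (auto simp: cond_prob_version_def)
    have "prob {z \<in> space M. X z \<in> B \<and> Y z} = (LINT x:B|distr M N X. f x)"
      using f B by (simp add: cond_prob_version_iff)
    also have "\<dots> = (LINT x:B|distr M N X. q)"
      unfolding set_lebesgue_integral_def by (rule integral_cong_AE) (use const in auto)
    also have "\<dots> = q * prob {z \<in> space M. X z \<in> B}"
      by (simp add: set_lebesgue_integral_def measure_distr) (auto intro!: arg_cong[where f=prob])
    finally show ?thesis .
  qed
  have "prob {z \<in> space M. X z \<in> space N \<and> Y z} = prob {z \<in> space M. Y z}"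
    "prob {z \<in> space M. X z \<in> space N} = 1"
    using measurable_space[OF X] by (auto intro!: arg_cong[where f=prob] simp: prob_space[symmetric])
  \<comment> \<open>Taking \<open>B\<close> to be the whole space identifies the constant.\<close>
  then have q: "prob {z \<in> space M. Y z} = q"
    using eq[OF sets.top] by simp
  show ?thesis
  proof (rule indep_setI)
    show "sets (vimage_algebra (space M) X N) \<subseteq> events"
      using measurable_space[OF X] by (auto simp: sets_vimage_algebra2)
    show "sets (vimage_algebra (space M) Y (count_space UNIV)) \<subseteq> events"
      by (auto simp: sets_vimage_algebra2)
    fix a b assume "a \<in> sets (vimage_algebra (space M) X N)" "b \<in> sets (vimage_algebra (space M) Y (count_space UNIV))"
    then obtain B C where a: "a = X -` B \<inter> space M" and B[measurable]: "B \<in> sets N" and b: "b = Y -` C \<inter> space M"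
      using measurable_space[OF X] by (auto simp: sets_vimage_algebra2)
    have a': "prob a = prob {z \<in> space M. X z \<in> B}"
      unfolding a by (auto intro!: arg_cong[where f=prob])
    have "prob {z \<in> space M. X z \<in> B \<and> \<not> Y z} = prob ({z \<in> space M. X z \<in> B} - {z \<in> space M. X z \<in> B \<and> Y z})"
      by (auto intro!: arg_cong[where f=prob])
    also have "\<dots> = prob {z \<in> space M. X z \<in> B} - q * prob {z \<in> space M. X z \<in> B}"
      by (subst finite_measure_Diff) (auto simp: eq[OF B])
    finally have neq: "prob {z \<in> space M. X z \<in> B \<and> \<not> Y z} = (1 - q) * prob {z \<in> space M. X z \<in> B}"
      by (simp add: algebra_simps)
    have nq: "prob {z \<in> space M. \<not> Y z} = 1 - q"
      using q by (subst prob_neg) auto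
    consider "C = {}" | "C = {True}" | "C = {False}" | "C = UNIV"
      using subset_UNIV[of C] unfolding UNIV_bool by auto
    then show "prob (a \<inter> b) = prob a * prob b"
    proof cases
      case 2
      then have "a \<inter> b = {z \<in> space M. X z \<in> B \<and> Y z}" "b = {z \<in> space M. Y z}" by (auto simp: a b)
      then show ?thesis by (simp add: eq a' q)
    next
      case 3
      then have "a \<inter> b = {z \<in> space M. X z \<in> B \<and> \<not> Y z}" "b = {z \<in> space M. \<not> Y z}" by (auto simp: a b)
      then show ?thesis by (simp add: neq a' nq)
    next
      case 4
      then have "a \<inter> b = a" "b = space M" by (auto simp: a b)
      then show ?thesis by (simp add: prob_space)
    qed (simp add: b)
  qed
qed

text \<open>If the variance of \<open>f (X z)\<close> were 0, \<open>f\<close> would be constant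
  almost everywhere and \<open>X\<close>, \<open>Y\<close> independent. With \<open>q = P[Y]\<close>
  this gives \<open>q^2 < E[f^2] <= E[f] = q\<close>, which excludes \<open>q = 0\<close> and
  \<open>q = 1\<close>.\<close>

lemma (in prob_space) second_moment_gt_if_dependent:
  fixes Y :: "'a \<Rightarrow> bool"
  assumes X[measurable]: "X \<in> measurable M N" and Y[measurable]: "Y \<in> measurable M (count_space UNIV)"
    and f: "cond_prob_version M X N Y f" and f01: "\<And>x. x \<in> space N \<Longrightarrow> f x \<in> {0..1}"
    and dep: "\<not> indep_set (sets (vimage_algebra (space M) X N)) (sets (vimage_algebra (space M) Y (count_space UNIV)))"
  shows "expectation (\<lambda>z. f (X z)) = prob {z \<in> space M. Y z}"
    and "(prob {z \<in> space M. Y z})\<^sup>2 < expectation (\<lambda>z. (f (X z))\<^sup>2)"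
    and "prob {z \<in> space M. Y z} \<in> {0<..<1}"
proof -
  define q where "q = prob {z \<in> space M. Y z}"
  have [measurable]: "f \<in> borel_measurable N" using f by (auto simp: cond_prob_version_def)
  have fX: "f (X z) \<in> {0..1}" if "z \<in> space M" for z using measurable_space[OF X that] f01 by blast
  have i1: "integrable M (\<lambda>z. f (X z))"
    by (rule integrable_const_bound[where B=1]) (use fX in \<open>auto intro!: AE_I2\<close>)
  have i2: "integrable M (\<lambda>z. (f (X z))\<^sup>2)"
    by (rule integrable_const_bound[where B=1]) (use fX in \<open>auto intro!: AE_I2 simp: power_le_one\<close>)
  show E: "expectation (\<lambda>z. f (X z)) = prob {z \<in> space M. Y z}"
    using cond_prob_version_integral[OF X _ f, of "\<lambda>_. 1"] by simp
  have var: "expectation (\<lambda>z. (f (X z) - q)\<^sup>2) = expectation (\<lambda>z. (f (X z))\<^sup>2) - q\<^sup>2"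
  proof -
    have "expectation (\<lambda>z. (f (X z) - q)\<^sup>2) = expectation (\<lambda>z. (f (X z))\<^sup>2 - 2 * q * f (X z) + q\<^sup>2)"
      by (simp add: power2_diff algebra_simps)
    also have "\<dots> = expectation (\<lambda>z. (f (X z))\<^sup>2) - 2 * q * expectation (\<lambda>z. f (X z)) + q\<^sup>2"
      using i1 i2 by (simp add: prob_space)
    finally show ?thesis
      unfolding E q_def by (simp add: power2_eq_square)
  qed
  show gt: "(prob {z \<in> space M. Y z})\<^sup>2 < expectation (\<lambda>z. (f (X z))\<^sup>2)"
  proof (rule ccontr)
    assume "\<not> ?thesis"
    then have "expectation (\<lambda>z. (f (X z) - q)\<^sup>2) \<le> 0" using var by (simp add: q_def)
    moreover have "0 \<le> expectation (\<lambda>z. (f (X z) - q)\<^sup>2)" by (intro integral_nonneg_AE AE_I2) simp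
    ultimately have "expectation (\<lambda>z. (f (X z) - q)\<^sup>2) = 0" by simp
    moreover have "integrable M (\<lambda>z. (f (X z) - q)\<^sup>2)"
      using i1 i2 by (simp add: power2_diff)
    ultimately have "AE z in M. (f (X z) - q)\<^sup>2 = 0"
      by (subst (asm) integral_nonneg_eq_0_iff_AE) auto
    then have "AE z in M. f (X z) = q" by eventually_elim simp
    then have "AE x in distr M N X. f x = q" by (subst AE_distr_iff) auto
    then show False using indep_if_cond_prob_const[OF X Y f] dep by blast
  qed
  have "expectation (\<lambda>z. (f (X z))\<^sup>2) \<le> expectation (\<lambda>z. f (X z))"
    using fX by (intro integral_mono i1 i2) (auto simp: power2_eq_square mult_left_le)
  then have "q\<^sup>2 < q" using gt E by (simp add: q_def)
  then have "q * (1 - q) > 0" by (simp add: power2_eq_square algebra_simps)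
  then show "prob {z \<in> space M. Y z} \<in> {0<..<1}"
    unfolding q_def[symmetric] by (auto simp: zero_less_mult_iff q_def not_less)
qed

section \<open>Pseudo-labels\<close>

context
  fixes \<X>\<^sub>S :: "'s measure" and \<X>\<^sub>U :: "'u measure" and P :: "('s \<times> 'u \<times> bool) measure" and fS :: "'s \<Rightarrow> real"
  assumes P: "prob_space P" and sets_P: "sets P = sets (data_space \<X>\<^sub>S \<X>\<^sub>U)"
    and fS[measurable]: "fS \<in> borel_measurable \<X>\<^sub>S" and fS01: "\<And>s. s \<in> space \<X>\<^sub>S \<Longrightarrow> fS s \<in> {0..1}"
begin

abbreviation (input) pseudo_label_space :: "('s \<times> 'u \<times> bool \<times> bool) measure" where
  "pseudo_label_space \<equiv> \<X>\<^sub>S \<Otimes>\<^sub>M \<X>\<^sub>U \<Otimes>\<^sub>M label_space \<Otimes>\<^sub>M label_space"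

abbreviation (input) pseudo_label_kernel :: "'s \<times> 'u \<times> bool \<Rightarrow> ('s \<times> 'u \<times> bool \<times> bool) measure" where
  "pseudo_label_kernel \<equiv> \<lambda>(s, u, y). distr (measure_pmf (bernoulli_pmf (fS s))) pseudo_label_space (\<lambda>yhat. (s, u, y, yhat))"

lemma space_data: "space P = space (data_space \<X>\<^sub>S \<X>\<^sub>U)"
  by (rule sets_eq_imp_space_eq[OF sets_P])

text \<open>The kernel has two atoms. The explicit weights make its measurability in the data point
  evident and reduce the pseudo-label law to a single integral over \<open>P\<close>.\<close>

lemma emeasure_pseudo_label_kernel:
  assumes z: "(s, u, y) \<in> space P" and A: "A \<in> sets pseudo_label_space"
  shows "emeasure (pseudo_label_kernel (s, u, y)) A =
    indicator A (s, u, y, True) * ennreal (fS s) + indicator A (s, u, y, False) * ennreal (1 - fS s)"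
proof -
  have sp: "s \<in> space \<X>\<^sub>S" "u \<in> space \<X>\<^sub>U"
    using z by (auto simp: space_data space_pair_measure)
  have m: "(\<lambda>yhat. (s, u, y, yhat)) \<in> measurable (measure_pmf (bernoulli_pmf (fS s))) pseudo_label_space"
    using sp by (auto simp: space_pair_measure)
  have "emeasure (pseudo_label_kernel (s, u, y)) A = (\<integral>\<^sup>+w. indicator A w \<partial>pseudo_label_kernel (s, u, y))"
    using A by simp
  also have "\<dots> = (\<integral>\<^sup>+yhat. indicator A (s, u, y, yhat) \<partial>bernoulli_pmf (fS s))"
    unfolding prod.case by (subst nn_integral_distr[OF m]) (use A in simp_all)
  also have "\<dots> = indicator A (s, u, y, True) * ennreal (fS s) + indicator A (s, u, y, False) * ennreal (1 - fS s)"
    using fS01[OF sp(1)] by (intro nn_integral_bernoulli_pmf) auto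
  finally show ?thesis .
qed

lemma pseudo_label_kernel_measurable: "pseudo_label_kernel \<in> measurable P (subprob_algebra pseudo_label_space)"
proof (rule measurable_subprob_algebra)
  note [measurable_cong] = sets_P
  fix z assume z: "z \<in> space P"
  then have sp: "fst z \<in> space \<X>\<^sub>S" "fst (snd z) \<in> space \<X>\<^sub>U"
    by (auto simp: space_data space_pair_measure)
  show "subprob_space (pseudo_label_kernel z)"
    unfolding split_def
    by (intro prob_space_imp_subprob_space prob_space.prob_space_distr measure_pmf.prob_space_axioms)
       (use sp in \<open>auto simp: space_pair_measure\<close>)
  show "sets (pseudo_label_kernel z) = sets pseudo_label_space"
    by (simp add: split_def)
next
  note [measurable_cong] = sets_P
  fix A assume A[measurable]: "A \<in> sets pseudo_label_space"
  have "(\<lambda>z. indicator A (fst z, fst (snd z), snd (snd z), True) * ennreal (fS (fst z))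
      + indicator A (fst z, fst (snd z), snd (snd z), False) * ennreal (1 - fS (fst z))) \<in> borel_measurable P"
    by measurable
  also have "?this \<longleftrightarrow> (\<lambda>z. emeasure (pseudo_label_kernel z) A) \<in> borel_measurable P"
  proof (rule measurable_cong)
    fix z assume "z \<in> space P"
    then show "indicator A (fst z, fst (snd z), snd (snd z), True) * ennreal (fS (fst z))
      + indicator A (fst z, fst (snd z), snd (snd z), False) * ennreal (1 - fS (fst z))
      = emeasure (pseudo_label_kernel z) A"
      using emeasure_pseudo_label_kernel[of "fst z" "fst (snd z)" "snd (snd z)" A] A by (simp add: split_def)
  qed
  finally show "(\<lambda>z. emeasure (pseudo_label_kernel z) A) \<in> borel_measurable P" .
qed

lemma prob_space_pseudo_label_law: "prob_space (pseudo_label_law \<X>\<^sub>S \<X>\<^sub>U P fS)"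
  unfolding pseudo_label_law_def
proof (rule prob_space.prob_space_bind[OF P _ pseudo_label_kernel_measurable], rule AE_I2)
  fix z assume z: "z \<in> space P"
  then have sp: "fst z \<in> space \<X>\<^sub>S" "fst (snd z) \<in> space \<X>\<^sub>U"
    by (auto simp: space_data space_pair_measure)
  show "prob_space (pseudo_label_kernel z)"
    unfolding split_def
    by (intro prob_space.prob_space_distr measure_pmf.prob_space_axioms)
       (use sp in \<open>auto simp: space_pair_measure\<close>)
qed

lemma sets_pseudo_label_law[simp, measurable_cong]:
  "sets (pseudo_label_law \<X>\<^sub>S \<X>\<^sub>U P fS) = sets pseudo_label_space"
  unfolding pseudo_label_law_def
  by (rule sets_bind_measurable[OF pseudo_label_kernel_measurable prob_space.not_empty[OF P]])

lemma emeasure_pseudo_label_law: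
  assumes A[measurable]: "A \<in> sets pseudo_label_space"
  shows "emeasure (pseudo_label_law \<X>\<^sub>S \<X>\<^sub>U P fS) A =
    (\<integral>\<^sup>+(s, u, y). indicator A (s, u, y, True) * ennreal (fS s) + indicator A (s, u, y, False) * ennreal (1 - fS s) \<partial>P)"
  unfolding pseudo_label_law_def emeasure_bind[OF prob_space.not_empty[OF P] pseudo_label_kernel_measurable A]
  by (intro nn_integral_cong) (use emeasure_pseudo_label_kernel[OF _ A] in auto)

text \<open>The weights of the two pseudo-labels add up to 1, so drawing a pseudo-label leaves the
  law of \<open>X_U\<close> unchanged. Statements about \<eta>tilde can therefore be read under
  \<open>P\<close>.\<close>

lemma distr_feat_U_pseudo_label_law:
  "distr (pseudo_label_law \<X>\<^sub>S \<X>\<^sub>U P fS) \<X>\<^sub>U (\<lambda>z. feat_U z) = distr P \<X>\<^sub>U (\<lambda>z. feat_U z)"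
proof (rule measure_eqI)
  note [measurable_cong] = sets_P
  fix B assume "B \<in> sets (distr (pseudo_label_law \<X>\<^sub>S \<X>\<^sub>U P fS) \<X>\<^sub>U (\<lambda>z. feat_U z))"
  then have B[measurable]: "B \<in> sets \<X>\<^sub>U" by simp
  let ?L = "pseudo_label_law \<X>\<^sub>S \<X>\<^sub>U P fS"
  have sp: "space ?L = space pseudo_label_space" by (rule sets_eq_imp_space_eq) simp
  have "emeasure (distr ?L \<X>\<^sub>U (\<lambda>z. feat_U z)) B = emeasure ?L {z \<in> space pseudo_label_space. feat_U z \<in> B}"
    by (subst emeasure_distr) (auto simp: sp intro!: arg_cong[where f="emeasure ?L"])
  also have "\<dots> = (\<integral>\<^sup>+z. indicator {z \<in> space P. feat_U z \<in> B} z \<partial>P)"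
  proof (subst emeasure_pseudo_label_law)
    show "(\<integral>\<^sup>+(s, u, y). indicator {z \<in> space pseudo_label_space. feat_U z \<in> B} (s, u, y, True) * ennreal (fS s)
        + indicator {z \<in> space pseudo_label_space. feat_U z \<in> B} (s, u, y, False) * ennreal (1 - fS s) \<partial>P)
      = (\<integral>\<^sup>+z. indicator {z \<in> space P. feat_U z \<in> B} z \<partial>P)"
    proof (intro nn_integral_cong)
      fix z assume z: "z \<in> space P"
      obtain s u y where z': "z = (s, u, y)" by (cases z)
      have "s \<in> space \<X>\<^sub>S" "u \<in> space \<X>\<^sub>U"
        using z by (auto simp: z' space_data space_pair_measure)
      moreover from this have "ennreal (fS s) + ennreal (1 - fS s) = 1"
        using fS01 by (auto simp: ennreal_plus[symmetric] simp del: ennreal_plus)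
      ultimately show "(case z of (s, u, y) \<Rightarrow> indicator {z \<in> space pseudo_label_space. feat_U z \<in> B} (s, u, y, True) * ennreal (fS s)
        + indicator {z \<in> space pseudo_label_space. feat_U z \<in> B} (s, u, y, False) * ennreal (1 - fS s))
        = indicator {z \<in> space P. feat_U z \<in> B} z"
        using z by (simp add: z' space_pair_measure indicator_def)
    qed
  qed measurable
  also have "\<dots> = emeasure (distr P \<X>\<^sub>U (\<lambda>z. feat_U z)) B"
    by (subst nn_integral_indicator, measurable, subst emeasure_distr)
       (auto intro!: arg_cong[where f="emeasure P"])
  finally show "emeasure (distr ?L \<X>\<^sub>U (\<lambda>z. feat_U z)) B = emeasure (distr P \<X>\<^sub>U (\<lambda>z. feat_U z)) B" .
qed simp

text \<open>Integrating out the pseudo-label replaces the event that it equals 1 by the weight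
  \<open>fS\<close>, so \<open>t\<close> is a version of the conditional expectation of
  \<open>fS\<close> given \<open>X_U\<close>. The conclusions have the form of the assumptions on
  \<open>t\<close> in \<open>cond_prob_version_from_pseudo_labels\<close>.\<close>

lemma pseudo_label_version:
  assumes t: "cond_prob_version (pseudo_label_law \<X>\<^sub>S \<X>\<^sub>U P fS)
          (\<lambda>z. feat_U z) \<X>\<^sub>U (\<lambda>(s, u, y, yhat). yhat) t"
  shows "t \<in> borel_measurable \<X>\<^sub>U" "integrable (distr P \<X>\<^sub>U (\<lambda>z. feat_U z)) t"
    and "B \<in> sets \<X>\<^sub>U \<Longrightarrow> (LINT u:B|distr P \<X>\<^sub>U (\<lambda>z. feat_U z). t u)
           = (LINT z:{z \<in> space P. feat_U z \<in> B}|P. fS (feat_S z))"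
proof -
  note [measurable_cong] = sets_P
  let ?L = "pseudo_label_law \<X>\<^sub>S \<X>\<^sub>U P fS"
  interpret L: prob_space ?L by (rule prob_space_pseudo_label_law)
  have sp: "space ?L = space pseudo_label_space" by (rule sets_eq_imp_space_eq) simp
  have iff: "t \<in> borel_measurable \<X>\<^sub>U \<and> integrable (distr P \<X>\<^sub>U (\<lambda>z. feat_U z)) t \<and>
    (\<forall>B\<in>sets \<X>\<^sub>U. (LINT u:B|distr P \<X>\<^sub>U (\<lambda>z. feat_U z). t u)
       = L.prob {z \<in> space ?L. feat_U z \<in> B \<and> (\<lambda>(s, u, y, yhat). yhat) z})"
    using t by (subst (asm) L.cond_prob_version_iff) (auto simp: distr_feat_U_pseudo_label_law)
  then show "t \<in> borel_measurable \<X>\<^sub>U" "integrable (distr P \<X>\<^sub>U (\<lambda>z. feat_U z)) t" by auto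
  assume B[measurable]: "B \<in> sets \<X>\<^sub>U"
  have "emeasure ?L {z \<in> space pseudo_label_space. feat_U z \<in> B \<and> snd (snd (snd z))}
      = (\<integral>\<^sup>+z. ennreal (indicator {z \<in> space P. feat_U z \<in> B} z *\<^sub>R fS (feat_S z)) \<partial>P)"
  proof (subst emeasure_pseudo_label_law)
    show "(\<integral>\<^sup>+(s, u, y). indicator {z \<in> space pseudo_label_space. feat_U z \<in> B \<and> snd (snd (snd z))} (s, u, y, True) * ennreal (fS s)
        + indicator {z \<in> space pseudo_label_space. feat_U z \<in> B \<and> snd (snd (snd z))} (s, u, y, False) * ennreal (1 - fS s) \<partial>P)
      = (\<integral>\<^sup>+z. ennreal (indicator {z \<in> space P. feat_U z \<in> B} z *\<^sub>R fS (feat_S z)) \<partial>P)"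
    proof (intro nn_integral_cong)
      fix z assume z: "z \<in> space P"
      obtain s u y where z': "z = (s, u, y)" by (cases z)
      have "s \<in> space \<X>\<^sub>S" "u \<in> space \<X>\<^sub>U"
        using z by (auto simp: z' space_data space_pair_measure)
      then show "(case z of (s, u, y) \<Rightarrow> indicator {z \<in> space pseudo_label_space. feat_U z \<in> B \<and> snd (snd (snd z))} (s, u, y, True) * ennreal (fS s)
        + indicator {z \<in> space pseudo_label_space. feat_U z \<in> B \<and> snd (snd (snd z))} (s, u, y, False) * ennreal (1 - fS s))
        = ennreal (indicator {z \<in> space P. feat_U z \<in> B} z *\<^sub>R fS (feat_S z))"
        using z by (simp add: z' space_pair_measure indicator_def)
    qed
  qed measurable
  moreover have "(LINT z:{z \<in> space P. feat_U z \<in> B}|P. fS (feat_S z))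
     = enn2real (\<integral>\<^sup>+z. ennreal (indicator {z \<in> space P. feat_U z \<in> B} z *\<^sub>R fS (feat_S z)) \<partial>P)"
    unfolding set_lebesgue_integral_def
    by (rule integral_eq_nn_integral)
      (use fS01 in \<open>auto intro!: AE_I2 simp: space_data space_pair_measure\<close>)
  ultimately show "(LINT u:B|distr P \<X>\<^sub>U (\<lambda>z. feat_U z). t u)
           = (LINT z:{z \<in> space P. feat_U z \<in> B}|P. fS (feat_S z))"
    using iff B by (simp add: measure_def sp split_def)
qed

end

section \<open>The estimator as a function of sample averages\<close>

text \<open>
  The denominator of \<open>bayes\<close> vanishes exactly when 0 and 1 both occur among the arguments, which is
  when the sum of logits contains \<open>\<infinity> - \<infinity>\<close>.
\<close>

lemma sigmoid_sum_or_logit: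
  assumes "f \<in> {0..1}" "g \<in> {0..1}" "r \<in> {0..1}"
  shows "sigmoid_sum_or c (logit f) (logit g) (logit r) =
    (if f * g * r + (1 - f) * (1 - g) * (1 - r) = 0 then c else bayes f g r)"
proof -
  have den: "f * g * r + (1 - f) * (1 - g) * (1 - r) = 0 \<longleftrightarrow> 0 \<in> {f, g, r} \<and> 1 \<in> {f, g, r}"
  proof -
    have "0 \<le> f * g * r" "0 \<le> (1 - f) * (1 - g) * (1 - r)" using assms by auto
    then have "f * g * r + (1 - f) * (1 - g) * (1 - r) = 0 \<longleftrightarrow> f * g * r = 0 \<and> (1 - f) * (1 - g) * (1 - r) = 0"
      by linarith
    then show ?thesis by auto
  qed
  have inf: "logit x = \<infinity> \<longleftrightarrow> x = 1" "logit x = - \<infinity> \<longleftrightarrow> x = 0" for x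
    by (auto simp: logit_def)
  have inf': "\<infinity> = logit x \<longleftrightarrow> 1 = x" "- \<infinity> = logit x \<longleftrightarrow> 0 = x" for x
    by (auto simp: logit_def)
  have undef: "(\<infinity> \<in> {logit f, logit g, logit r} \<and> - \<infinity> \<in> {logit f, logit g, logit r}) \<longleftrightarrow> 0 \<in> {f, g, r} \<and> 1 \<in> {f, g, r}"
    by (simp add: inf inf') blast
  show ?thesis
  proof (cases "0 \<in> {f, g, r} \<and> 1 \<in> {f, g, r}")
    case True
    then show ?thesis unfolding sigmoid_sum_or_def undef den by simp
  next
    case False
    have fin: "\<exists>a. logit x = ereal a" if "x \<noteq> 0" "x \<noteq> 1" for x using that by (auto simp: logit_def)
    have "sigmoid (logit f + logit g + logit r) = bayes f g r"
    proof -
      \<comment> \<open>With 0 and 1 not both present, the sum of logits is minus infinity, plus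
        infinity or finite; in the first two cases \<open>bayes\<close> is 0 or 1 because one of its
        two summands vanishes.\<close>
      consider "0 \<in> {f, g, r}" "1 \<notin> {f, g, r}" | "1 \<in> {f, g, r}" "0 \<notin> {f, g, r}" | "0 \<notin> {f, g, r}" "1 \<notin> {f, g, r}"
        using False by blast
      then show ?thesis
      proof cases
        case 1
        then have "logit f + logit g + logit r = - \<infinity>"
          using inf[of f] inf[of g] inf[of r]
          by (cases "logit f"; cases "logit g"; cases "logit r") auto
        with 1 show ?thesis by (auto simp: sigmoid_def bayes_def)
      next
        case 2
        then have "logit f + logit g + logit r = \<infinity>"
          using inf[of f] inf[of g] inf[of r]
          by (cases "logit f"; cases "logit g"; cases "logit r") auto
        with 2 show ?thesis by (auto simp: sigmoid_def bayes_def)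
      next
        case 3
        with assms have *: "0 < f" "f < 1" "0 < g" "g < 1" "0 < r" "r < 1"
          by (auto simp: less_le)
        have "exp (- (ln (f / (1 - f)) + ln (g / (1 - g)) + ln (r / (1 - r))))
            = ((1 - f) * (1 - g) * (1 - r)) / (f * g * r)"
          unfolding exp_minus exp_add using * by simp
        then have "sigmoid (logit f + logit g + logit r) = 1 / (1 + ((1 - f) * (1 - g) * (1 - r)) / (f * g * r))"
          using 3 * by (simp add: logit_def sigmoid_def)
        also have "\<dots> = bayes f g r"
          using * by (simp add: bayes_def divide_simps)
        finally show ?thesis .
      qed
    qed
    then show ?thesis unfolding sigmoid_sum_or_def undef den by (simp only: False if_False)
  qed
qed

text \<open>Turns the subtracted logit of the estimator into a third summand, so that
  \<open>sigmoid_sum_or_logit\<close> applies; the endpoints 0 and 1 exchange the two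
  infinities.\<close>

lemma minus_logit:
  assumes "p \<in> {0..1}"
  shows "- logit p = logit (1 - p)"
proof (cases "p = 0 \<or> p = 1")
  case False
  with assms have "0 < p" "p < 1" by auto
  then show ?thesis by (simp add: logit_def ln_div)
qed (auto simp: logit_def)

text \<open>Closed form of \<open>sigmoid_sum_or\<close> at three logits. The fallback
  \<open>c\<close> replaces the value 0 that \<open>bayes\<close> takes at a zero
  denominator.\<close>

definition posterior_or :: "real \<Rightarrow> real \<Rightarrow> real \<Rightarrow> real \<Rightarrow> real" where
  "posterior_or c f g r = (if f * g * r + (1 - f) * (1 - g) * (1 - r) = 0 then c else bayes f g r)"

lemma posterior_or_range:
  assumes "c \<in> {0..1}" "f \<in> {0..1}" "g \<in> {0..1}" "r \<in> {0..1}"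
  shows "posterior_or c f g r \<in> {0..1}"
  using assms bayes_range unfolding posterior_or_def by simp

text \<open>For \<open>n = 0\<close> the quotient is 0, so the bound covers all \<open>n\<close>,
  and the closed form of the estimator below holds from the first index on.\<close>

lemma n_one_range:
  assumes "\<And>i. i \<in> {1..n} \<Longrightarrow> fS (xs i) \<in> {0..1}"
  shows "n_one fS xs n / real n \<in> {0..1}"
proof -
  have "0 \<le> n_one fS xs n" unfolding n_one_def using assms by (intro sum_nonneg) auto
  moreover have "n_one fS xs n \<le> (\<Sum>i=1..n. 1)" unfolding n_one_def using assms by (intro sum_mono) auto
  ultimately show ?thesis by (auto simp: divide_simps)
qed

lemma eta_hat_eq:
  assumes "fS s \<in> {0..1}" "\<And>i. i \<in> {1..n} \<Longrightarrow> fS (xs i) \<in> {0..1}"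
  shows "eta_hat c0 c1 cf ce fS xs n ft s u =
    posterior_or ce (fS s) (fU_hat c0 c1 cf fS xs n ft u) (1 - n_one fS xs n / real n)"
proof -
  have "fU_hat c0 c1 cf fS xs n ft u \<in> {0..1}" by (auto simp: fU_hat_def)
  then show ?thesis
    using assms n_one_range[of n fS xs] sigmoid_sum_or_logit[of "fS s" "fU_hat c0 c1 cf fS xs n ft u" "1 - n_one fS xs n / real n" ce]
    unfolding eta_hat_def posterior_or_def by (simp add: minus_logit)
qed

lemma eta_hat_range:
  assumes "ce \<in> {0..1}" "fS s \<in> {0..1}" "\<And>i. i \<in> {1..n} \<Longrightarrow> fS (xs i) \<in> {0..1}"
  shows "eta_hat c0 c1 cf ce fS xs n ft s u \<in> {0..1}"
proof -
  have "posterior_or ce (fS s) (fU_hat c0 c1 cf fS xs n ft u) (1 - n_one fS xs n / real n) \<in> {0..1}"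
    using assms n_one_range[of n fS xs] by (intro posterior_or_range) (auto simp: fU_hat_def)
  then show ?thesis using assms by (subst eta_hat_eq) auto
qed

section \<open>The estimator in terms of the averages of \<open>fS\<close> and of its square\<close>

definition clamp01 :: "real \<Rightarrow> real" where
  "clamp01 x = max 0 (min 1 x)"

text \<open>\<open>a\<close> and \<open>b\<close> stand for the averages of \<open>fS\<close> and of
  its square, \<open>t\<close> for the value of the pseudo-label estimate. Expanding the square, the
  average of \<open>(1 - fS)^2\<close> is \<open>1 - 2 * a + b\<close>.\<close>

definition eta_of_averages :: "real \<Rightarrow> real \<Rightarrow> real \<Rightarrow> real \<Rightarrow> real \<Rightarrow> real \<Rightarrow> real \<Rightarrow> real \<Rightarrow> real" where
  "eta_of_averages c0 c1 cf ce f a b t =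
     (let e0 = div_or c0 (1 - 2 * a + b) (1 - a); e1 = div_or c1 b a
      in posterior_or ce f (clamp01 (div_or cf (t + e0 - 1) (e0 + e1 - 1))) (1 - a))"

lemma eta_hat_eq_averages:
  assumes "fS s \<in> {0..1}" "\<And>i. i \<in> {1..n} \<Longrightarrow> fS (xs i) \<in> {0..1}" "n > 0"
  shows "eta_hat c0 c1 cf ce fS xs n ft s u =
    eta_of_averages c0 c1 cf ce (fS s) ((\<Sum>i=1..n. fS (xs i)) / real n) ((\<Sum>i=1..n. (fS (xs i))\<^sup>2) / real n) (ft u)"
proof -
  define A where "A = (\<Sum>i=1..n. fS (xs i))"
  define B where "B = (\<Sum>i=1..n. (fS (xs i))\<^sup>2)"
  have n_one: "n_one fS xs n = A" by (simp add: n_one_def A_def)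
  have "(\<Sum>i=1..n. (1 - fS (xs i))\<^sup>2) = real n - 2 * A + B"
    by (simp add: power2_diff sum.distrib sum_subtractf A_def B_def sum_distrib_left)
  \<comment> \<open>Numerator and denominator are both divided by \<open>n > 0\<close>, so the
    quotient is unchanged and the fallback \<open>c0\<close> is taken in the same cases.\<close>
  then have e0: "eps0_hat c0 fS xs n = div_or c0 (1 - 2 * (A / n) + B / n) (1 - A / n)"
    using \<open>n > 0\<close> unfolding eps0_hat_def n_one div_or_def
    by (simp add: diff_divide_distrib[symmetric] add_divide_distrib[symmetric] divide_simps)
  have e1: "eps1_hat c1 fS xs n = div_or c1 (B / n) (A / n)"
    using \<open>n > 0\<close> unfolding eps1_hat_def n_one B_def[symmetric] div_or_def by simp
  have eq: "eta_hat c0 c1 cf ce fS xs n ft s u =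
    posterior_or ce (fS s) (fU_hat c0 c1 cf fS xs n ft u) (1 - n_one fS xs n / real n)"
    by (rule eta_hat_eq) (use assms in blast)+
  show ?thesis
    unfolding eq A_def[symmetric] B_def[symmetric] fU_hat_def e0 e1
    by (simp add: eta_of_averages_def Let_def clamp01_def n_one)
qed

text \<open>Near a nonzero limit the denominator is eventually nonzero, so the fallback value
  disappears in the limit. The same idea serves \<open>tendsto_posterior_or\<close>.\<close>

lemma tendsto_div_or:
  assumes "(a \<longlongrightarrow> x) F" "(b \<longlongrightarrow> y) F" "y \<noteq> 0"
  shows "((\<lambda>i. div_or c (a i) (b i)) \<longlongrightarrow> x / y) F"
proof -
  have "\<forall>\<^sub>F i in F. b i \<noteq> 0" using tendsto_imp_eventually_ne[OF assms(2,3)] .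
  then have "\<forall>\<^sub>F i in F. a i / b i = div_or c (a i) (b i)"
    by eventually_elim (simp add: div_or_def)
  with tendsto_divide[OF assms] show ?thesis by (rule Lim_transform_eventually)
qed

lemma tendsto_posterior_or:
  assumes "(g \<longlongrightarrow> g') F" "(r \<longlongrightarrow> r') F" "f * g' * r' + (1 - f) * (1 - g') * (1 - r') \<noteq> 0"
  shows "((\<lambda>i. posterior_or c f (g i) (r i)) \<longlongrightarrow> bayes f g' r') F"
proof -
  have "((\<lambda>i. f * g i * r i + (1 - f) * (1 - g i) * (1 - r i)) \<longlongrightarrow> f * g' * r' + (1 - f) * (1 - g') * (1 - r')) F"
    by (intro tendsto_intros assms)
  then have "\<forall>\<^sub>F i in F. f * g i * r i + (1 - f) * (1 - g i) * (1 - r i) \<noteq> 0"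
    using assms(3) by (rule tendsto_imp_eventually_ne)
  then have "\<forall>\<^sub>F i in F. bayes f (g i) (r i) = posterior_or c f (g i) (r i)"
    by eventually_elim (simp add: posterior_or_def)
  moreover have "((\<lambda>i. bayes f (g i) (r i)) \<longlongrightarrow> bayes f g' r') F"
    unfolding bayes_def by (intro tendsto_intros assms)
  ultimately show ?thesis by (rule Lim_transform_eventually[rotated])
qed

text \<open>Continuity at the population values: all four denominators, \<open>1 - q\<close>,
  \<open>q\<close>, \<open>e0 + e1 - 1\<close> and that of \<open>bayes\<close>, are nonzero there.
  The filter is arbitrary because the lemma is applied along sequences for almost sure convergence
  and along neighbourhoods for convergence in probability.\<close>

lemma tendsto_eta_of_averages:
  assumes a: "(a \<longlongrightarrow> q) F" and b: "(b \<longlongrightarrow> m) F" and t: "(t \<longlongrightarrow> \<tau>) F"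
    and q: "q \<in> {0<..<1}" and e: "e0 = (1 - 2 * q + m) / (1 - q)" "e1 = m / q" "e0 + e1 \<noteq> 1"
    and g: "g = clamp01 ((\<tau> + e0 - 1) / (e0 + e1 - 1))"
    and den: "f * g * (1 - q) + (1 - f) * (1 - g) * q \<noteq> 0"
  shows "((\<lambda>i. eta_of_averages c0 c1 cf ce f (a i) (b i) (t i)) \<longlongrightarrow> bayes f g (1 - q)) F"
proof -
  have e0: "((\<lambda>i. div_or c0 (1 - 2 * a i + b i) (1 - a i)) \<longlongrightarrow> e0) F"
    unfolding e by (intro tendsto_div_or tendsto_intros a b) (use q in auto)
  have e1: "((\<lambda>i. div_or c1 (b i) (a i)) \<longlongrightarrow> e1) F"
    unfolding e by (intro tendsto_div_or tendsto_intros a b) (use q in auto)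
  show ?thesis
    unfolding eta_of_averages_def Let_def g clamp01_def
    by (intro tendsto_posterior_or tendsto_div_or tendsto_intros e0 e1 t a)
      (use e(3) den in \<open>auto simp: g clamp01_def\<close>)
qed

lemma measurable_div_or[measurable]:
  assumes [measurable]: "f \<in> borel_measurable M" "g \<in> borel_measurable M"
  shows "(\<lambda>x. div_or c (f x) (g x)) \<in> borel_measurable M"
  unfolding div_or_def by measurable

lemma measurable_posterior_or[measurable]:
  assumes [measurable]: "f \<in> borel_measurable M" "g \<in> borel_measurable M" "r \<in> borel_measurable M"
  shows "(\<lambda>x. posterior_or c (f x) (g x) (r x)) \<in> borel_measurable M"
  unfolding posterior_or_def bayes_def by measurable

text \<open>Joint measurability is checked on the rational closed form, which agrees with the logit
  expression on the whole product space.\<close>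

lemma measurable_eta_hat:
  assumes fS[measurable]: "fS \<in> borel_measurable S" and fS01: "\<And>s. s \<in> space S \<Longrightarrow> fS s \<in> {0..1}"
    and XS: "\<And>i. i \<ge> 1 \<Longrightarrow> XS i \<in> measurable \<Omega> S"
    and ft[measurable]: "(\<lambda>(w, u). ft w u) \<in> borel_measurable (\<Omega> \<Otimes>\<^sub>M U)"
  shows "(\<lambda>(w, s, u). eta_hat c0 c1 cf ce fS (\<lambda>i. XS i w) n (ft w) s u) \<in> borel_measurable (\<Omega> \<Otimes>\<^sub>M S \<Otimes>\<^sub>M U)"
proof -
  \<comment> \<open>Samples are numbered from 1; nothing is assumed about
    \<open>XS 0\<close>.\<close>
  have XS': "(\<lambda>w. fS (XS i w)) \<in> borel_measurable \<Omega>" if "i \<in> {1..n}" for i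
    using that by (intro measurable_compose[OF XS fS]) auto
  have n_one[measurable]: "(\<lambda>w. n_one fS (\<lambda>i. XS i w) n) \<in> borel_measurable \<Omega>"
    unfolding n_one_def by (intro borel_measurable_sum XS')
  have [measurable]: "(\<lambda>w. \<Sum>i=1..n. (1 - fS (XS i w))\<^sup>2) \<in> borel_measurable \<Omega>"
    by (intro borel_measurable_sum borel_measurable_power borel_measurable_diff borel_measurable_const XS')
  have [measurable]: "(\<lambda>w. \<Sum>i=1..n. (fS (XS i w))\<^sup>2) \<in> borel_measurable \<Omega>"
    by (intro borel_measurable_sum borel_measurable_power XS')
  have [measurable]: "(\<lambda>w. eps0_hat c0 fS (\<lambda>i. XS i w) n) \<in> borel_measurable \<Omega>"
    "(\<lambda>w. eps1_hat c1 fS (\<lambda>i. XS i w) n) \<in> borel_measurable \<Omega>"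
    unfolding eps0_hat_def eps1_hat_def by measurable
  have "(\<lambda>p. posterior_or ce (fS (fst (snd p)))
      (max 0 (min 1 (div_or cf ((\<lambda>(w, u). ft w u) (fst p, snd (snd p)) + eps0_hat c0 fS (\<lambda>i. XS i (fst p)) n - 1)
          (eps0_hat c0 fS (\<lambda>i. XS i (fst p)) n + eps1_hat c1 fS (\<lambda>i. XS i (fst p)) n - 1))))
      (1 - n_one fS (\<lambda>i. XS i (fst p)) n / real n)) \<in> borel_measurable (\<Omega> \<Otimes>\<^sub>M S \<Otimes>\<^sub>M U)"
    by measurable
  also have "?this \<longleftrightarrow> ?thesis"
  proof (rule measurable_cong)
    fix p assume "p \<in> space (\<Omega> \<Otimes>\<^sub>M S \<Otimes>\<^sub>M U)"
    then obtain w s u where p: "p = (w, s, u)" "w \<in> space \<Omega>" "s \<in> space S" "u \<in> space U"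
      by (auto simp: space_pair_measure)
    have "fS (XS i w) \<in> {0..1}" if "i \<in> {1..n}" for i
      using that measurable_space[OF XS p(2)] fS01 by simp
    then have "eta_hat c0 c1 cf ce fS (\<lambda>i. XS i w) n (ft w) s u =
      posterior_or ce (fS s) (fU_hat c0 c1 cf fS (\<lambda>i. XS i w) n (ft w) u) (1 - n_one fS (\<lambda>i. XS i w) n / real n)"
      using fS01 p by (intro eta_hat_eq) auto
    then show "posterior_or ce (fS (fst (snd p)))
      (max 0 (min 1 (div_or cf ((\<lambda>(w, u). ft w u) (fst p, snd (snd p)) + eps0_hat c0 fS (\<lambda>i. XS i (fst p)) n - 1)
          (eps0_hat c0 fS (\<lambda>i. XS i (fst p)) n + eps1_hat c1 fS (\<lambda>i. XS i (fst p)) n - 1))))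
      (1 - n_one fS (\<lambda>i. XS i (fst p)) n / real n) =
      (\<lambda>(w, s, u). eta_hat c0 c1 cf ce fS (\<lambda>i. XS i w) n (ft w) s u) p"
      by (simp add: p fU_hat_def)
  qed
  finally show ?thesis .
qed

section \<open>Convergence in probability and almost surely\<close>

text \<open>Hoeffding's inequality bounds the deviation probabilities by a geometric sequence. It
  tends to 0, which is the weak law, and is summable, which gives the strong law by
  Borel-Cantelli.\<close>

lemma (in prob_space) bounded_lln:
  fixes X :: "nat \<Rightarrow> 'a \<Rightarrow> real"
  assumes indep: "indep_vars (\<lambda>_. borel) X {1..}"
    and distr: "\<And>i. i \<ge> 1 \<Longrightarrow> distr M borel (X i) = distr M borel (X 1)"
    and range: "\<And>i w. i \<ge> 1 \<Longrightarrow> w \<in> space M \<Longrightarrow> X i w \<in> {0..1}"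
  shows "tendsto_in_prob M (\<lambda>n w. (\<Sum>i=1..n. X i w) / real n) (expectation (X 1))" (is ?weak)
    and "AE w in M. (\<lambda>n. (\<Sum>i=1..n. X i w) / real n) \<longlonglongrightarrow> expectation (X 1)" (is ?strong)
proof -
  define \<mu> where "\<mu> = expectation (X 1)"
  define avg where "avg = (\<lambda>n w. (\<Sum>i=1..n. X i w) / real n)"
  have X: "X i \<in> borel_measurable M" if "i \<in> {1..n}" for i n
    using indep that unfolding indep_vars_def by auto
  have avg[measurable]: "avg n \<in> borel_measurable M" for n
    unfolding avg_def by (intro borel_measurable_divide borel_measurable_sum X borel_measurable_const)
  have bound: "prob {w \<in> space M. \<bar>avg n w - \<mu>\<bar> > e} \<le> 2 * exp (- (2 * e\<^sup>2)) ^ n" if e: "e > 0" and n: "n > 0" for n e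
  proof -
    interpret H: Hoeffding_ineq_iid M "{1..n}" X "X 1" 0 1 \<mu>
    proof unfold_locales
      show "indep_vars (\<lambda>_. borel) X {1..n}" by (rule indep_vars_subset[OF indep]) auto
      show "AE x in M. X 1 x \<in> {0..1}" using range by (intro AE_I2) auto
      show "random_variable borel (X 1)" using X[of 1 1] by simp
      show "distr M borel (X i) = distr M borel (X 1)" if "i \<in> {1..n}" for i
        using that by (intro distr) simp
    qed (simp_all add: \<mu>_def)
    have "prob {w \<in> space M. \<bar>avg n w - \<mu>\<bar> > e} \<le> prob {w \<in> space M. \<bar>avg n w - \<mu>\<bar> \<ge> e}"
      by (intro finite_measure_mono) auto
    also have "\<dots> \<le> 2 * exp (- 2 * n * e\<^sup>2 / (1 - 0)\<^sup>2)"
      using H.Hoeffding_ineq_abs_ge'[of e] e n by (simp add: avg_def)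
    also have "\<dots> = 2 * exp (- (2 * e\<^sup>2)) ^ n"
      unfolding exp_of_nat_mult[symmetric] by (simp add: mult_ac)
    finally show ?thesis .
  qed
  have geo: "summable (\<lambda>n. 2 * exp (- (2 * e\<^sup>2)) ^ n)" if "e > 0" for e :: real
    using that by (intro summable_mult summable_geometric) auto
  have weak: "tendsto_in_prob M avg \<mu>"
    unfolding tendsto_in_prob_def
  proof (intro conjI allI impI)
    fix e :: real assume e: "e > 0"
    show "(\<lambda>n. prob {w \<in> space M. \<bar>avg n w - \<mu>\<bar> > e}) \<longlonglongrightarrow> 0"
    proof (rule tendsto_sandwich[OF _ _ tendsto_const summable_LIMSEQ_zero[OF geo[OF e]]])
      show "\<forall>\<^sub>F n in sequentially. prob {w \<in> space M. \<bar>avg n w - \<mu>\<bar> > e} \<le> 2 * exp (- (2 * e\<^sup>2)) ^ n"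
        using eventually_gt_at_top[of 0] by eventually_elim (rule bound[OF e])
    qed simp
  qed (rule avg)
  \<comment> \<open>The radii \<open>1 / (k + 1)\<close> form a countable family, so the exceptional
    null sets can be united.\<close>
  have "AE w in M. \<forall>\<^sub>F n in sequentially. \<bar>avg n w - \<mu>\<bar> \<le> 1 / real (Suc k)" for k
  proof -
    let ?e = "1 / real (Suc k)"
    have "AE w in M. \<forall>\<^sub>F n in sequentially. w \<in> space M - {w \<in> space M. \<bar>avg n w - \<mu>\<bar> > ?e}"
    proof (rule borel_cantelli_AE1)
      show "summable (\<lambda>n. prob {w \<in> space M. \<bar>avg n w - \<mu>\<bar> > ?e})"
      proof (rule summable_comparison_test_ev[OF _ geo[of ?e]])
        show "\<forall>\<^sub>F n in sequentially. norm (prob {w \<in> space M. \<bar>avg n w - \<mu>\<bar> > ?e}) \<le> 2 * exp (- (2 * ?e\<^sup>2)) ^ n"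
          using eventually_gt_at_top[of 0]
        proof eventually_elim
          case (elim n)
          then show ?case using bound[of ?e n] by simp
        qed
      qed simp
    qed (auto simp: emeasure_eq_measure)
    then show ?thesis
      by eventually_elim (auto elim: eventually_mono)
  qed
  then have "AE w in M. \<forall>k. \<forall>\<^sub>F n in sequentially. \<bar>avg n w - \<mu>\<bar> \<le> 1 / real (Suc k)"
    by (subst AE_all_countable) auto
  then have "AE w in M. (\<lambda>n. avg n w) \<longlonglongrightarrow> \<mu>"
  proof eventually_elim
    case (elim w)
    show ?case
    proof (rule tendstoI)
      fix e :: real assume "e > 0"
      then obtain k where k: "1 / real (Suc k) < e" using nat_approx_posE by blast
      from elim have "\<forall>\<^sub>F n in sequentially. \<bar>avg n w - \<mu>\<bar> \<le> 1 / real (Suc k)" by blast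
      then show "\<forall>\<^sub>F n in sequentially. dist (avg n w) \<mu> < e"
        by eventually_elim (use k in \<open>auto simp: dist_real_def\<close>)
    qed
  qed
with weak show ?weak ?strong by (simp_all add: avg_def \<mu>_def)
qed

text \<open>Continuous mapping at a single limit point: a deviation of \<open>W\<close> forces one
  of the three arguments out of its neighbourhood, and a union bound finishes. The representation of
  \<open>W\<close> is asked for eventually only, since the averages describe the estimator for
  positive \<open>n\<close>.\<close>

lemma (in prob_space) tendsto_in_prob_continuous3:
  assumes X: "tendsto_in_prob M X a" and Y: "tendsto_in_prob M Y b" and Z: "tendsto_in_prob M Z c"
    and W[measurable]: "\<And>n. W n \<in> borel_measurable M"
    and eq: "\<forall>\<^sub>F n in sequentially. \<forall>w\<in>space M. W n w = h (X n w, Y n w, Z n w)"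
    and h: "(h \<longlongrightarrow> l) (nhds a \<times>\<^sub>F nhds b \<times>\<^sub>F nhds c)"
  shows "tendsto_in_prob M W l"
  unfolding tendsto_in_prob_def
proof (intro conjI allI impI)
  fix e :: real assume e: "e > 0"
  have XYZ[measurable]: "X n \<in> borel_measurable M" "Y n \<in> borel_measurable M" "Z n \<in> borel_measurable M" for n
    using X Y Z by (auto simp: tendsto_in_prob_def)
  have "\<forall>\<^sub>F p in nhds a \<times>\<^sub>F nhds b \<times>\<^sub>F nhds c. dist (h p) l < e"
    using h e by (rule tendstoD)
  then obtain Pa Pb Pc where P: "eventually Pa (nhds a)" "eventually Pb (nhds b)" "eventually Pc (nhds c)"
    and hP: "\<And>x y z. Pa x \<Longrightarrow> Pb y \<Longrightarrow> Pc z \<Longrightarrow> dist (h (x, y, z)) l < e"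
    unfolding eventually_prod_filter by (metis (no_types, lifting))
  obtain da db dc where d: "da > 0" "db > 0" "dc > 0"
    and P': "\<And>x. dist x a < da \<Longrightarrow> Pa x" "\<And>x. dist x b < db \<Longrightarrow> Pb x" "\<And>x. dist x c < dc \<Longrightarrow> Pc x"
    using P unfolding eventually_nhds_metric by blast
  \<comment> \<open>With threshold \<open>d / 2\<close>, the complement of the event lies in the
    open ball of radius \<open>d\<close>.\<close>
  let ?A = "\<lambda>V v d n. {w \<in> space M. \<bar>V n w - v\<bar> > d / 2}"
  have half: "(\<lambda>n. prob (?A V v d n)) \<longlonglongrightarrow> 0" if "tendsto_in_prob M V v" "d > 0" for V v d
    using that(1) half_gt_zero[OF that(2)] unfolding tendsto_in_prob_def by blast
  have "(\<lambda>n. prob (?A X a da n) + prob (?A Y b db n) + prob (?A Z c dc n)) \<longlonglongrightarrow> 0 + 0 + 0"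
    by (intro tendsto_add half X Y Z d)
  then have lim: "(\<lambda>n. prob (?A X a da n) + prob (?A Y b db n) + prob (?A Z c dc n)) \<longlonglongrightarrow> 0" by simp
  show "(\<lambda>n. prob {w \<in> space M. \<bar>W n w - l\<bar> > e}) \<longlonglongrightarrow> 0"
  proof (rule tendsto_sandwich[OF _ _ tendsto_const lim])
    show "\<forall>\<^sub>F n in sequentially. prob {w \<in> space M. \<bar>W n w - l\<bar> > e}
        \<le> prob (?A X a da n) + prob (?A Y b db n) + prob (?A Z c dc n)"
      using eq
    proof eventually_elim
      case (elim n)
      have "w \<in> ?A X a da n \<union> ?A Y b db n \<union> ?A Z c dc n" if w: "w \<in> space M" "\<bar>W n w - l\<bar> > e" for w
      proof (rule ccontr)
        assume "\<not> ?thesis"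
        then have "dist (X n w) a < da" "dist (Y n w) b < db" "dist (Z n w) c < dc"
          using d w by (auto simp: dist_real_def not_less)
        then have "dist (h (X n w, Y n w, Z n w)) l < e" by (intro hP P')
        then show False using elim w by (auto simp: dist_real_def)
      qed
      then have "prob {w \<in> space M. \<bar>W n w - l\<bar> > e} \<le> prob (?A X a da n \<union> ?A Y b db n \<union> ?A Z c dc n)"
        by (intro finite_measure_mono) auto
      also have "\<dots> \<le> prob (?A X a da n \<union> ?A Y b db n) + prob (?A Z c dc n)"
        by (intro measure_Un_le) auto
      also have "prob (?A X a da n \<union> ?A Y b db n) \<le> prob (?A X a da n) + prob (?A Y b db n)"
        by (intro measure_Un_le) auto
      finally show ?case by simp
    qed
  qed simp
qed (rule W)

text \<open>Bounded convergence: up to \<open>e / 2\<close>, a function with values in [0,1] is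
  dominated by the indicator of exceeding \<open>e / 2\<close>.\<close>

lemma (in prob_space) tendsto_in_prob_imp_expectation:
  assumes G: "tendsto_in_prob M G 0" and range: "\<And>n w. w \<in> space M \<Longrightarrow> G n w \<in> {0..1}"
  shows "(\<lambda>n. expectation (G n)) \<longlonglongrightarrow> 0"
proof (rule tendstoI)
  fix e :: real assume e: "e > 0"
  have [measurable]: "G n \<in> borel_measurable M" for n using G by (auto simp: tendsto_in_prob_def)
  have "(\<lambda>n. prob {w \<in> space M. \<bar>G n w - 0\<bar> > e / 2}) \<longlonglongrightarrow> 0"
    using G e unfolding tendsto_in_prob_def by (meson half_gt_zero)
  then have "\<forall>\<^sub>F n in sequentially. prob {w \<in> space M. \<bar>G n w - 0\<bar> > e / 2} < e / 2"
    using e by (intro order_tendstoD(2)) auto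
  then show "\<forall>\<^sub>F n in sequentially. dist (expectation (G n)) 0 < e"
  proof eventually_elim
    case (elim n)
    have "expectation (G n) \<le> expectation (\<lambda>w. e / 2 + indicator {w \<in> space M. \<bar>G n w - 0\<bar> > e / 2} w)"
    proof (rule integral_mono)
      show "integrable M (G n)"
        by (rule integrable_const_bound[where B=1]) (use range in \<open>auto intro!: AE_I2\<close>)
      show "integrable M (\<lambda>w. e / 2 + indicator {w \<in> space M. \<bar>G n w - 0\<bar> > e / 2} w)"
        by (auto simp: emeasure_eq_measure intro!: integrable_real_indicator)
      show "G n w \<le> e / 2 + indicator {w \<in> space M. \<bar>G n w - 0\<bar> > e / 2} w" if "w \<in> space M" for w
        using range[OF that, of n] e that by (auto simp: indicator_def)
    qed
    also have "\<dots> = e / 2 + prob {w \<in> space M. \<bar>G n w - 0\<bar> > e / 2}"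
      by (subst Bochner_Integration.integral_add)
         (auto simp: emeasure_eq_measure prob_space intro!: integrable_real_indicator)
    also have "\<dots> < e" using elim by simp
    finally have "expectation (G n) < e" .
    moreover have "0 \<le> expectation (G n)" using range by (intro integral_nonneg_AE AE_I2) auto
    ultimately show ?case by simp
  qed
qed

section \<open>Integrals of jointly measurable random functions\<close>

context
  fixes \<Omega> :: "'w measure" and M :: "'x measure" and G :: "nat \<Rightarrow> 'w \<Rightarrow> 'x \<Rightarrow> real"
  assumes \<Omega>: "prob_space \<Omega>" and M: "prob_space M"
    and G[measurable]: "\<And>n. (\<lambda>(w, x). G n w x) \<in> borel_measurable (\<Omega> \<Otimes>\<^sub>M M)"
    and range: "\<And>n w x. w \<in> space \<Omega> \<Longrightarrow> x \<in> space M \<Longrightarrow> G n w x \<in> {0..1}"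
begin

interpretation \<Omega>: prob_space \<Omega> by (rule \<Omega>)
interpretation M: prob_space M by (rule M)
interpretation MO: pair_prob_space M \<Omega> ..
interpretation OM: pair_prob_space \<Omega> M ..

text \<open>For almost every \<open>x\<close> the mean of \<open>G n w x\<close> over
  \<open>w\<close> tends to 0, hence so does the double integral by dominated convergence. Fubini
  exchanges the order, and Markov's inequality turns the mean of the inner integral into a
  probability.\<close>

lemma tendsto_in_prob_integral:
  assumes "AE x in M. tendsto_in_prob \<Omega> (\<lambda>n w. G n w x) 0"
  shows "tendsto_in_prob \<Omega> (\<lambda>n w. \<integral>x. G n w x \<partial>M) 0"
proof -
  have int: "integrable (\<Omega> \<Otimes>\<^sub>M M) (\<lambda>(w, x). G n w x)" for n
    by (rule OM.P.integrable_const_bound[where B=1]) (use range in \<open>auto intro!: AE_I2 simp: space_pair_measure\<close>)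
  have nn: "0 \<le> (\<integral>x. G n w x \<partial>M)" if "w \<in> space \<Omega>" for n w
    using range[OF that] by (intro integral_nonneg_AE AE_I2) auto
  have "(\<lambda>n. \<integral>x. (\<integral>w. G n w x \<partial>\<Omega>) \<partial>M) \<longlonglongrightarrow> (\<integral>x. 0 \<partial>M)"
  proof (rule integral_dominated_convergence[where w="\<lambda>_. 1"])
    show "AE x in M. (\<lambda>n. \<integral>w. G n w x \<partial>\<Omega>) \<longlonglongrightarrow> 0"
      using assms AE_space
    proof eventually_elim
      case (elim x)
      then show ?case using range by (intro \<Omega>.tendsto_in_prob_imp_expectation) auto
    qed
    show "AE x in M. norm (\<integral>w. G n w x \<partial>\<Omega>) \<le> 1" for n
    proof (rule AE_I2)
      fix x assume x: "x \<in> space M"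
      then have [measurable]: "(\<lambda>w. G n w x) \<in> borel_measurable \<Omega>" by measurable
      have "(\<integral>w. G n w x \<partial>\<Omega>) \<le> (\<integral>w. 1 \<partial>\<Omega>)"
        using range x by (intro integral_mono \<Omega>.integrable_const_bound[where B=1]) (auto intro!: AE_I2)
      moreover have "0 \<le> (\<integral>w. G n w x \<partial>\<Omega>)"
        using range x by (intro integral_nonneg_AE AE_I2) auto
      ultimately show "norm (\<integral>w. G n w x \<partial>\<Omega>) \<le> 1" by (simp add: \<Omega>.prob_space)
    qed
  qed auto
  then have lim: "(\<lambda>n. \<integral>w. (\<integral>x. G n w x \<partial>M) \<partial>\<Omega>) \<longlonglongrightarrow> 0"
    using OM.Fubini_integral[OF int] by simp
  show ?thesis
    unfolding tendsto_in_prob_def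
  proof (intro conjI allI impI)
    fix e :: real assume e: "e > 0"
    have lim': "(\<lambda>n. (\<integral>w. (\<integral>x. G n w x \<partial>M) \<partial>\<Omega>) / e) \<longlonglongrightarrow> 0"
      using tendsto_divide[OF lim tendsto_const[of e]] e by simp
    show "(\<lambda>n. \<Omega>.prob {w \<in> space \<Omega>. \<bar>(\<integral>x. G n w x \<partial>M) - 0\<bar> > e}) \<longlonglongrightarrow> 0"
    proof (rule tendsto_sandwich[OF _ _ tendsto_const lim'])
      have "\<Omega>.prob {w \<in> space \<Omega>. \<bar>(\<integral>x. G n w x \<partial>M) - 0\<bar> > e} \<le> (\<integral>w. (\<integral>x. G n w x \<partial>M) \<partial>\<Omega>) / e" for n
      proof -
        have "\<Omega>.prob {w \<in> space \<Omega>. \<bar>(\<integral>x. G n w x \<partial>M) - 0\<bar> > e} \<le> \<Omega>.prob {w \<in> space \<Omega>. (\<integral>x. G n w x \<partial>M) \<ge> e}"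
          using nn by (intro \<Omega>.finite_measure_mono) (auto simp: abs_of_nonneg)
        also have "\<dots> \<le> (\<integral>w. (\<integral>x. G n w x \<partial>M) \<partial>\<Omega>) / e"
          using OM.integrable_fst[OF int] nn e
          by (intro integral_Markov_inequality_measure[where A="space \<Omega>"]) (auto intro!: AE_I2)
        finally show ?thesis .
      qed
      then show "\<forall>\<^sub>F n in sequentially. \<Omega>.prob {w \<in> space \<Omega>. \<bar>(\<integral>x. G n w x \<partial>M) - 0\<bar> > e} \<le> (\<integral>w. (\<integral>x. G n w x \<partial>M) \<partial>\<Omega>) / e"
        by simp
    qed simp
  qed measurable
qed

text \<open>The exceptional set of \<open>w\<close> may depend on \<open>x\<close>. Fubini exchanges
  the two almost-everywhere quantifiers, and dominated convergence then applies for each remaining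
  \<open>w\<close>.\<close>

lemma AE_tendsto_integral:
  assumes "AE x in M. AE w in \<Omega>. (\<lambda>n. G n w x) \<longlonglongrightarrow> 0"
  shows "AE w in \<Omega>. (\<lambda>n. \<integral>x. G n w x \<partial>M) \<longlonglongrightarrow> 0"
proof -
  \<comment> \<open>The countable description of convergence makes the set of convergence measurable
    in the product space, as the exchange of quantifiers requires.\<close>
  have iff: "(\<lambda>n. G n w x) \<longlonglongrightarrow> 0 \<longleftrightarrow> (\<forall>k. \<exists>N. \<forall>n. N \<le> n \<longrightarrow> \<bar>G n w x\<bar> \<le> 1 / real (Suc k))" for w x
  proof
    assume L: "(\<lambda>n. G n w x) \<longlonglongrightarrow> 0"
    show "\<forall>k. \<exists>N. \<forall>n. N \<le> n \<longrightarrow> \<bar>G n w x\<bar> \<le> 1 / real (Suc k)"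
    proof
      fix k
      have "\<forall>\<^sub>F n in sequentially. dist (G n w x) 0 < 1 / real (Suc k)"
        using L by (rule tendstoD) simp
      then show "\<exists>N. \<forall>n. N \<le> n \<longrightarrow> \<bar>G n w x\<bar> \<le> 1 / real (Suc k)"
        unfolding eventually_sequentially by (auto intro: less_imp_le)
    qed
  next
    assume R: "\<forall>k. \<exists>N. \<forall>n. N \<le> n \<longrightarrow> \<bar>G n w x\<bar> \<le> 1 / real (Suc k)"
    show "(\<lambda>n. G n w x) \<longlonglongrightarrow> 0"
    proof (rule tendstoI)
      fix e :: real assume "e > 0"
      then obtain k where k: "1 / real (Suc k) < e" using nat_approx_posE by blast
      from R obtain N where "\<forall>n. N \<le> n \<longrightarrow> \<bar>G n w x\<bar> \<le> 1 / real (Suc k)" by blast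
      with k show "\<forall>\<^sub>F n in sequentially. dist (G n w x) 0 < e"
        unfolding eventually_sequentially by (auto simp: dist_real_def intro!: exI[of _ N] intro: le_less_trans)
    qed
  qed
  have "AE w in \<Omega>. AE x in M. (\<lambda>n. G n w x) \<longlonglongrightarrow> 0"
  proof (subst MO.AE_commute[symmetric])
    show "{p \<in> space (M \<Otimes>\<^sub>M \<Omega>). (\<lambda>n. G n (snd p) (fst p)) \<longlonglongrightarrow> 0} \<in> sets (M \<Otimes>\<^sub>M \<Omega>)"
      unfolding iff by measurable
  qed (rule assms)
  then show ?thesis
    using AE_space
  proof eventually_elim
    case (elim w)
    have "(\<lambda>n. \<integral>x. G n w x \<partial>M) \<longlonglongrightarrow> (\<integral>x. 0 \<partial>M)"
    proof (rule integral_dominated_convergence[where w="\<lambda>_. 1"])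
      show "AE x in M. (\<lambda>n. G n w x) \<longlonglongrightarrow> 0" using elim by simp
      show "(\<lambda>x. G n w x) \<in> borel_measurable M" for n using elim by measurable
      show "AE x in M. norm (G n w x) \<le> 1" for n using range elim by (intro AE_I2) auto
    qed auto
    then show ?case by simp
  qed
qed

end

lemma (in prob_space) tendsto_in_prob_sandwich:
  assumes I: "tendsto_in_prob M I 0" and W[measurable]: "\<And>n. W n \<in> borel_measurable M"
    and le: "\<And>n w. w \<in> space M \<Longrightarrow> \<bar>W n w - c\<bar> \<le> 2 * I n w"
  shows "tendsto_in_prob M W c"
  unfolding tendsto_in_prob_def
proof (intro conjI allI impI)
  fix e :: real assume e: "e > 0"
  have [measurable]: "I n \<in> borel_measurable M" for n using I by (auto simp: tendsto_in_prob_def)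
  have lim: "(\<lambda>n. prob {w \<in> space M. \<bar>I n w - 0\<bar> > e / 2}) \<longlonglongrightarrow> 0"
    using I half_gt_zero[OF e] unfolding tendsto_in_prob_def by blast
  show "(\<lambda>n. prob {w \<in> space M. \<bar>W n w - c\<bar> > e}) \<longlonglongrightarrow> 0"
  proof (rule tendsto_sandwich[OF _ _ tendsto_const lim])
    have "prob {w \<in> space M. \<bar>W n w - c\<bar> > e} \<le> prob {w \<in> space M. \<bar>I n w - 0\<bar> > e / 2}" for n
      using le[of _ n] by (intro finite_measure_mono) (fastforce, measurable)
    then show "\<forall>\<^sub>F n in sequentially. prob {w \<in> space M. \<bar>W n w - c\<bar> > e} \<le> prob {w \<in> space M. \<bar>I n w - 0\<bar> > e / 2}"
      by simp
  qed simp
qed (rule W)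

lemma tendsto_in_prob_abs_diff:
  assumes "tendsto_in_prob M W c"
  shows "tendsto_in_prob M (\<lambda>n w. \<bar>W n w - c\<bar>) 0"
proof -
  have [measurable]: "W n \<in> borel_measurable M" for n using assms by (auto simp: tendsto_in_prob_def)
  show ?thesis using assms by (auto simp: tendsto_in_prob_def)
qed

section \<open>Plug-in risk and the theorem\<close>

text \<open>Errors split into false positives and false negatives, each an event of \<open>X\<close>
  intersected with \<open>A\<close> or its complement, so the defining integrals of \<open>g\<close>
  and \<open>1 - g\<close> apply.\<close>

lemma (in prob_space) misclassification_prob:
  assumes X[measurable]: "X \<in> measurable M N" and A[measurable]: "Measurable.pred M A"
    and g: "cond_prob_version M X N A g" and h[measurable]: "Measurable.pred N h"
  shows "prob {z \<in> space M. h (X z) \<noteq> A z} = (\<integral>x. (if h x then 1 - g x else g x) \<partial>distr M N X)"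
proof -
  interpret D: prob_space "distr M N X" by (rule prob_space_distr) simp
  have gm[measurable]: "g \<in> borel_measurable N" and gi: "integrable (distr M N X) g"
    using g by (auto simp: cond_prob_version_iff)
  have "prob {z \<in> space M. h (X z) \<noteq> A z} =
      prob ({z \<in> space M. X z \<in> {x \<in> space N. h x} \<and> \<not> A z} \<union> {z \<in> space M. X z \<in> {x \<in> space N. \<not> h x} \<and> A z})"
    using measurable_space[OF X] by (intro arg_cong[where f=prob]) auto
  also have "\<dots> = prob {z \<in> space M. X z \<in> {x \<in> space N. h x} \<and> \<not> A z} + prob {z \<in> space M. X z \<in> {x \<in> space N. \<not> h x} \<and> A z}"
    by (intro finite_measure_Union) auto
  also have "prob {z \<in> space M. X z \<in> {x \<in> space N. h x} \<and> \<not> A z} = (LINT x:{x \<in> space N. h x}|distr M N X. 1 - g x)"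
    using cond_prob_version_not[OF X A g] by (subst (asm) cond_prob_version_iff) auto
  also have "prob {z \<in> space M. X z \<in> {x \<in> space N. \<not> h x} \<and> A z} = (LINT x:{x \<in> space N. \<not> h x}|distr M N X. g x)"
    using g by (subst (asm) cond_prob_version_iff) auto
  also have "(LINT x:{x \<in> space N. h x}|distr M N X. 1 - g x) + (LINT x:{x \<in> space N. \<not> h x}|distr M N X. g x)
     = (\<integral>x. indicator {x \<in> space N. h x} x *\<^sub>R (1 - g x) + indicator {x \<in> space N. \<not> h x} x *\<^sub>R g x \<partial>distr M N X)"
    unfolding set_lebesgue_integral_def
    by (rule Bochner_Integration.integral_add[symmetric])
      (intro integrable_mult_indicator Bochner_Integration.integrable_diff D.integrable_const gi, simp)+
  also have "\<dots> = (\<integral>x. (if h x then 1 - g x else g x) \<partial>distr M N X)"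
    by (intro Bochner_Integration.integral_cong) auto
  finally show ?thesis .
qed

text \<open>Where the two rules agree the conditional errors coincide. Where they disagree, 1/2
  separates \<open>e x\<close> and \<open>g x\<close>, so the conditional errors differ by
  \<open>|1 - 2 * g x| <= 2 * |e x - g x|\<close>.\<close>

lemma (in prob_space) plug_in_excess_risk:
  assumes X[measurable]: "X \<in> measurable M N" and A[measurable]: "Measurable.pred M A"
    and g: "cond_prob_version M X N A g"
    and e[measurable]: "e \<in> borel_measurable N" and e01: "\<And>x. x \<in> space N \<Longrightarrow> e x \<in> {0..1}"
  shows "\<bar>prob {z \<in> space M. (e (X z) > 1/2) \<noteq> A z} - prob {z \<in> space M. (g (X z) > 1/2) \<noteq> A z}\<bar>
    \<le> 2 * (\<integral>x. \<bar>e x - g x\<bar> \<partial>distr M N X)"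
proof -
  interpret D: prob_space "distr M N X" by (rule prob_space_distr) simp
  have gm[measurable]: "g \<in> borel_measurable N" and gi: "integrable (distr M N X) g"
    using g by (auto simp: cond_prob_version_iff)
  have ei: "integrable (distr M N X) e"
    by (rule D.integrable_const_bound[where B=1]) (use e01 in \<open>auto intro!: AE_I2\<close>)
  let ?r = "\<lambda>h x. if h x then 1 - g x else g x"
  have ri: "integrable (distr M N X) (?r h)" if [measurable]: "Measurable.pred N h" for h
  proof (rule Bochner_Integration.integrable_bound[where f="\<lambda>x. 1 + \<bar>g x\<bar>"])
    show "integrable (distr M N X) (\<lambda>x. 1 + \<bar>g x\<bar>)" using gi by simp
  qed (auto intro!: AE_I2)
  have "\<bar>prob {z \<in> space M. (e (X z) > 1/2) \<noteq> A z} - prob {z \<in> space M. (g (X z) > 1/2) \<noteq> A z}\<bar>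
    = \<bar>\<integral>x. ?r (\<lambda>x. e x > 1/2) x - ?r (\<lambda>x. g x > 1/2) x \<partial>distr M N X\<bar>"
    using misclassification_prob[OF X A g, of "\<lambda>x. e x > 1/2"] misclassification_prob[OF X A g, of "\<lambda>x. g x > 1/2"]
      Bochner_Integration.integral_diff[OF ri ri, of "\<lambda>x. e x > 1/2" "\<lambda>x. g x > 1/2"] by simp
  also have "\<dots> \<le> (\<integral>x. \<bar>?r (\<lambda>x. e x > 1/2) x - ?r (\<lambda>x. g x > 1/2) x\<bar> \<partial>distr M N X)"
    by (rule integral_abs_bound)
  also have "\<dots> \<le> (\<integral>x. 2 * \<bar>e x - g x\<bar> \<partial>distr M N X)"
  proof (rule integral_mono)
    show "integrable (distr M N X) (\<lambda>x. \<bar>?r (\<lambda>x. e x > 1/2) x - ?r (\<lambda>x. g x > 1/2) x\<bar>)"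
      by (intro integrable_abs Bochner_Integration.integrable_diff ri) measurable
    show "integrable (distr M N X) (\<lambda>x. 2 * \<bar>e x - g x\<bar>)" using ei gi by simp
  qed auto
  finally show ?thesis by simp
qed

theorem theorem4p6:
  fixes \<X>\<^sub>S :: "'s measure" and \<X>\<^sub>U :: "'u measure"
    and Env :: "'e set" and Q :: "'e \<Rightarrow> ('s \<times> 'u \<times> bool) measure"
    and test :: 'e and P :: "('s \<times> 'u \<times> bool) measure"
    and fS :: "'s \<Rightarrow> real"
    and \<Omega> :: "'w measure" and XS :: "nat \<Rightarrow> 'w \<Rightarrow> 's" and XU :: "nat \<Rightarrow> 'w \<Rightarrow> 'u"
    and ftilde :: "nat \<Rightarrow> 'w \<Rightarrow> 'u \<Rightarrow> real"
    and c0 c1 cf ce :: real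
    and \<eta>tilde :: "'u \<Rightarrow> real" and \<eta> :: "'s \<Rightarrow> 'u \<Rightarrow> real"
  assumes std_S: "standard_borel \<X>\<^sub>S" and std_U: "standard_borel \<X>\<^sub>U"
    and env_prob: "\<And>e. e \<in> Env \<Longrightarrow> prob_space (Q e)"
    and env_sets: "\<And>e. e \<in> Env \<Longrightarrow> sets (Q e) = sets (data_space \<X>\<^sub>S \<X>\<^sub>U)"
    and fS_range: "\<And>s. s \<in> space \<X>\<^sub>S \<Longrightarrow> fS s \<in> {0..1}"
    and stable: "\<And>e. e \<in> Env \<Longrightarrow> cond_prob_version (Q e) (\<lambda>z. feat_S z) \<X>\<^sub>S (\<lambda>z. label z) fS"
    and fS_measurable: "fS \<in> borel_measurable \<X>\<^sub>S"
    and complementary: "\<And>e. e \<in> Env \<Longrightarrow>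
          cond_indep_given (Q e) \<X>\<^sub>S (\<lambda>z. feat_S z) \<X>\<^sub>U (\<lambda>z. feat_U z) (\<lambda>z. label z)"
    and test_env: "test \<in> Env" "P = Q test"
    and informative: "\<not> prob_space.indep_set P
          (sets (vimage_algebra (space P) (\<lambda>z. feat_S z) \<X>\<^sub>S))
          (sets (vimage_algebra (space P) (\<lambda>z. label z) label_space))"
    and samples_prob: "prob_space \<Omega>"
    and samples_indep:
      "prob_space.indep_vars \<Omega> (\<lambda>_. \<X>\<^sub>S \<Otimes>\<^sub>M \<X>\<^sub>U) (\<lambda>i w. (XS i w, XU i w)) {1..}"
    and samples_distr: "\<And>i. i \<ge> 1 \<Longrightarrow>
          distr \<Omega> (\<X>\<^sub>S \<Otimes>\<^sub>M \<X>\<^sub>U) (\<lambda>w. (XS i w, XU i w)) =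
          distr P (\<X>\<^sub>S \<Otimes>\<^sub>M \<X>\<^sub>U) (\<lambda>z. (feat_S z, feat_U z))"
    and ftilde_measurable: "\<And>n. (\<lambda>(w, u). ftilde n w u) \<in> borel_measurable (\<Omega> \<Otimes>\<^sub>M \<X>\<^sub>U)"
    and ftilde_range: "\<And>n w u. w \<in> space \<Omega> \<Longrightarrow> u \<in> space \<X>\<^sub>U \<Longrightarrow> ftilde n w u \<in> {0..1}"
    and undef_values: "c0 \<in> {0..1}" "c1 \<in> {0..1}" "cf \<in> {0..1}" "ce \<in> {0..1}"
    and \<eta>tilde: "cond_prob_version (pseudo_label_law \<X>\<^sub>S \<X>\<^sub>U P fS)
          (\<lambda>z. feat_U z) \<X>\<^sub>U (\<lambda>(s, u, y, yhat). yhat) \<eta>tilde"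
    and \<eta>: "cond_prob_version P (\<lambda>z. (feat_S z, feat_U z)) (\<X>\<^sub>S \<Otimes>\<^sub>M \<X>\<^sub>U) (\<lambda>z. label z)
          (\<lambda>(s, u). \<eta> s u)"
  defines "\<eta>hat \<equiv> \<lambda>n w. eta_hat c0 c1 cf ce fS (\<lambda>i. XS i w) n (ftilde n w)"
    and "hhat \<equiv> \<lambda>n w. h_hat c0 c1 cf ce fS (\<lambda>i. XS i w) n (ftilde n w)"
    and "hstar \<equiv> \<lambda>s u. \<eta> s u > 1/2"
    and "P_U \<equiv> distr P \<X>\<^sub>U (\<lambda>z. feat_U z)"
    and "P_SU \<equiv> distr P (\<X>\<^sub>S \<Otimes>\<^sub>M \<X>\<^sub>U) (\<lambda>z. (feat_S z, feat_U z))"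
  shows "((AE u in P_U. tendsto_in_prob \<Omega> (\<lambda>n w. ftilde n w u) (\<eta>tilde u)) \<longrightarrow>
            (AE (s, u) in P_SU. tendsto_in_prob \<Omega> (\<lambda>n w. \<eta>hat n w s u) (\<eta> s u)) \<and>
            tendsto_in_prob \<Omega> (\<lambda>n w. risk P (hhat n w)) (risk P hstar))
       \<and> ((AE u in P_U. AE w in \<Omega>. (\<lambda>n. ftilde n w u) \<longlonglongrightarrow> \<eta>tilde u) \<longrightarrow>
            (AE (s, u) in P_SU. AE w in \<Omega>. (\<lambda>n. \<eta>hat n w s u) \<longlonglongrightarrow> \<eta> s u) \<and>
            (AE w in \<Omega>. (\<lambda>n. risk P (hhat n w)) \<longlonglongrightarrow> risk P hstar))"
proof -
  interpret P: prob_space P using env_prob[OF test_env(1)] test_env(2) by simp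
  interpret \<Omega>: prob_space \<Omega> by (rule samples_prob)
  have sets_P: "sets P = sets (data_space \<X>\<^sub>S \<X>\<^sub>U)" using env_sets[OF test_env(1)] test_env(2) by simp
  note [measurable_cong] = sets_P
  note [measurable] = fS_measurable
  let ?N = "\<X>\<^sub>S \<Otimes>\<^sub>M \<X>\<^sub>U"
  have featS[measurable]: "(\<lambda>z. feat_S z) \<in> measurable P \<X>\<^sub>S"
    and featU[measurable]: "(\<lambda>z. feat_U z) \<in> measurable P \<X>\<^sub>U"
    and featSU[measurable]: "(\<lambda>z. (feat_S z, feat_U z)) \<in> measurable P ?N"
    and lab[measurable]: "(\<lambda>z. label z) \<in> measurable P label_space"
    by measurable
  have fS_version: "cond_prob_version P (\<lambda>z. feat_S z) \<X>\<^sub>S (\<lambda>z. label z) fS"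
    using stable[OF test_env(1)] test_env(2) by simp
  have indep: "cond_indep_given P \<X>\<^sub>S (\<lambda>z. feat_S z) \<X>\<^sub>U (\<lambda>z. feat_U z) (\<lambda>z. label z)"
    using complementary[OF test_env(1)] test_env(2) by simp
  interpret SU: prob_space P_SU unfolding P_SU_def by (rule P.prob_space_distr) simp
  have sets_SU[measurable_cong]: "sets P_SU = sets ?N" by (simp add: P_SU_def)
  have space_SU: "space P_SU = space ?N" by (simp add: P_SU_def)

  \<comment> \<open>Class probability and pseudo-label accuracies\<close>
  define q where "q = P.prob {z \<in> space P. label z}"
  define m where "m = P.expectation (\<lambda>z. (fS (feat_S z))\<^sup>2)"
  define e0 where "e0 = (1 - 2 * q + m) / (1 - q)"
  define e1 where "e1 = m / q"
  have Ef: "P.expectation (\<lambda>z. fS (feat_S z)) = q" and m_gt: "q\<^sup>2 < m" and q01: "q \<in> {0<..<1}"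
    using P.second_moment_gt_if_dependent[OF featS lab fS_version fS_range informative]
    by (simp_all only: q_def m_def)
  have "e0 + e1 - 1 = (m - q\<^sup>2) / (q * (1 - q))"
    using q01 by (simp add: e0_def e1_def divide_simps power2_eq_square) (simp add: algebra_simps)
  then have e_neq: "e0 + e1 \<noteq> 1" using m_gt q01 by auto
  have not_label: "P.prob {z \<in> space P. \<not> label z} = 1 - q"
    unfolding q_def by (subst P.prob_neg) auto

  \<comment> \<open>Recovering the posterior given \<open>X_U\<close> from pseudo-labels\<close>
  define fU where "fU = (\<lambda>u. clamp01 ((\<eta>tilde u + e0 - 1) / (e0 + e1 - 1)))"
  have fU_range: "fU u \<in> {0..1}" for u by (auto simp: fU_def clamp01_def)
  note pseudo = pseudo_label_version[OF P.prob_space_axioms sets_P fS_measurable fS_range \<eta>tilde]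
  note [measurable] = pseudo(1)
  have fU_version': "cond_prob_version P (\<lambda>z. feat_U z) \<X>\<^sub>U (\<lambda>z. label z) (\<lambda>u. (\<eta>tilde u + e0 - 1) / (e0 + e1 - 1))"
    using P.cond_prob_version_from_pseudo_labels[OF featS featU lab indep q_def q01 fS_version fS_range m_def
        e0_def e1_def e_neq pseudo] .
  \<comment> \<open>A version lies in [0,1] almost everywhere, so clamping alters it on a null set
    only. The clamped version has values in [0,1] everywhere, as \<open>cond_indep_posterior\<close>
    demands, and mirrors the clamping in the estimator.\<close>
  have fU_version: "cond_prob_version P (\<lambda>z. feat_U z) \<X>\<^sub>U (\<lambda>z. label z) fU"
  proof (rule P.cond_prob_version_cong_AE[OF featU fU_version'])
    show "fU \<in> borel_measurable \<X>\<^sub>U" unfolding fU_def clamp01_def by measurable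
    show "AE u in distr P \<X>\<^sub>U (\<lambda>z. feat_U z). (\<eta>tilde u + e0 - 1) / (e0 + e1 - 1) = fU u"
      using P.cond_prob_version_range[OF featU _ fU_version'] by (auto simp: fU_def clamp01_def elim: eventually_mono)
  qed
  have [measurable]: "fU \<in> borel_measurable \<X>\<^sub>U" using fU_version by (auto simp: cond_prob_version_def)

  \<comment> \<open>The joint posterior\<close>
  define b where "b = (\<lambda>(s, u). bayes (fS s) (fU u) (1 - q))"
  have b_version: "cond_prob_version P (\<lambda>z. (feat_S z, feat_U z)) ?N (\<lambda>z. label z) b"
    and den: "AE (s, u) in P_SU. fS s * fU u * (1 - q) + (1 - fS s) * (1 - fU u) * q > 0"
    using P.cond_indep_posterior[OF featS featU lab indep q01[unfolded q_def] fS_version fS_range fU_version fU_range]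
    unfolding b_def P_SU_def not_label by simp_all
  have [measurable]: "b \<in> borel_measurable ?N" "(\<lambda>(s, u). \<eta> s u) \<in> borel_measurable ?N"
    using b_version \<eta> by (auto simp: cond_prob_version_def)
  have b01: "b p \<in> {0..1}" if "p \<in> space ?N" for p
    using that fS_range fU_range q01 bayes_range[of "fS (fst p)" "fU (snd p)" "1 - q"]
    by (cases p) (auto simp: b_def space_pair_measure)
  \<comment> \<open>\<eta> is an arbitrary version, while \<open>b\<close> is explicit; the limits
    are proved for \<open>b\<close> and transferred along this equality.\<close>
  have \<eta>_eq: "AE p in P_SU. (\<lambda>(s, u). \<eta> s u) p = b p"
    unfolding P_SU_def by (rule P.cond_prob_version_AE_unique[OF featSU _ \<eta> b_version]) simp

  \<comment> \<open>Laws of large numbers for the samples\<close>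
  have samples: "(\<lambda>w. (XS i w, XU i w)) \<in> measurable \<Omega> ?N" if "i \<ge> 1" for i
    using samples_indep that unfolding \<Omega>.indep_vars_def by auto
  have XS: "XS i \<in> measurable \<Omega> \<X>\<^sub>S" if "i \<ge> 1" for i
    using measurable_compose[OF samples[OF that] measurable_fst] by simp
  have avg: "tendsto_in_prob \<Omega> (\<lambda>n w. (\<Sum>i=1..n. g (XS i w)) / real n) (P.expectation (\<lambda>z. g (feat_S z)))"
    "AE w in \<Omega>. (\<lambda>n. (\<Sum>i=1..n. g (XS i w)) / real n) \<longlonglongrightarrow> P.expectation (\<lambda>z. g (feat_S z))"
    if g[measurable]: "g \<in> borel_measurable \<X>\<^sub>S" and g01: "\<And>s. s \<in> space \<X>\<^sub>S \<Longrightarrow> g s \<in> {0..1}" for g :: "'s \<Rightarrow> real"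
  proof -
    \<comment> \<open>Only the law of the pair of features is given, so the law of
      \<open>g (XS i w)\<close> is obtained by pushing the pair forward along its first
      component.\<close>
    have distr: "distr \<Omega> borel (\<lambda>w. g (XS i w)) = distr P borel (\<lambda>z. g (feat_S z))" if "i \<ge> 1" for i
    proof -
      have "distr \<Omega> borel (\<lambda>w. g (XS i w)) = distr (distr \<Omega> ?N (\<lambda>w. (XS i w, XU i w))) borel (\<lambda>p. g (fst p))"
        by (subst distr_distr[OF _ samples[OF that]]) (simp_all add: comp_def)
      also have "\<dots> = distr P borel (\<lambda>z. g (feat_S z))"
        unfolding samples_distr[OF that] by (subst distr_distr) (simp_all add: comp_def)
      finally show ?thesis .
    qed
    have ind: "\<Omega>.indep_vars (\<lambda>_. borel) (\<lambda>i w. g (XS i w)) {1..}"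
      using \<Omega>.indep_vars_compose2[OF samples_indep, of "\<lambda>_ p. g (fst p)" "\<lambda>_. borel"] by simp
    have "\<Omega>.expectation (\<lambda>w. g (XS 1 w)) = (\<integral>x. x \<partial>distr \<Omega> borel (\<lambda>w. g (XS 1 w)))"
      using measurable_compose[OF XS[of 1] g] by (subst integral_distr) simp_all
    also have "\<dots> = P.expectation (\<lambda>z. g (feat_S z))"
      unfolding distr[OF order_refl] by (subst integral_distr) simp_all
    finally have E: "\<Omega>.expectation (\<lambda>w. g (XS 1 w)) = P.expectation (\<lambda>z. g (feat_S z))" .
    have d: "distr \<Omega> borel (\<lambda>w. g (XS i w)) = distr \<Omega> borel (\<lambda>w. g (XS 1 w))" if "i \<ge> 1" for i
      unfolding distr[OF that] distr[OF order_refl] ..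
    have r: "g (XS i w) \<in> {0..1}" if "i \<ge> 1" "w \<in> space \<Omega>" for i w
      using measurable_space[OF XS[OF that(1)] that(2)] by (rule g01)
    show "tendsto_in_prob \<Omega> (\<lambda>n w. (\<Sum>i=1..n. g (XS i w)) / real n) (P.expectation (\<lambda>z. g (feat_S z)))"
      "AE w in \<Omega>. (\<lambda>n. (\<Sum>i=1..n. g (XS i w)) / real n) \<longlonglongrightarrow> P.expectation (\<lambda>z. g (feat_S z))"
      using \<Omega>.bounded_lln[OF ind d r] unfolding E by blast+
  qed
  let ?a = "\<lambda>n w. (\<Sum>i=1..n. fS (XS i w)) / real n" and ?b = "\<lambda>n w. (\<Sum>i=1..n. (fS (XS i w))\<^sup>2) / real n"
  have a_lim: "tendsto_in_prob \<Omega> ?a q" "AE w in \<Omega>. (\<lambda>n. ?a n w) \<longlonglongrightarrow> q"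
    using avg[OF fS_measurable fS_range] by (simp_all only: Ef)
  have b_lim: "tendsto_in_prob \<Omega> ?b m" "AE w in \<Omega>. (\<lambda>n. ?b n w) \<longlonglongrightarrow> m"
    using avg[of "\<lambda>s. (fS s)\<^sup>2"] fS_range by (simp_all add: m_def power_le_one)

  \<comment> \<open>Range, measurability and limits of the estimator\<close>
  have fS_XS: "fS (XS i w) \<in> {0..1}" if "i \<in> {1..n}" "w \<in> space \<Omega>" for i n w
    using that measurable_space[OF XS that(2), of i] by (intro fS_range) simp
  let ?H = "\<lambda>s. eta_of_averages c0 c1 cf ce (fS s)"
  have \<eta>hat_avg: "\<eta>hat n w s u = ?H s (?a n w) (?b n w) (ftilde n w u)"
    if "n > 0" "w \<in> space \<Omega>" "s \<in> space \<X>\<^sub>S" for n w s u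
    unfolding \<eta>hat_def using that fS_range fS_XS by (intro eta_hat_eq_averages) auto
  have \<eta>hat_range: "\<eta>hat n w s u \<in> {0..1}" if "w \<in> space \<Omega>" "s \<in> space \<X>\<^sub>S" for n w s u
    unfolding \<eta>hat_def using that fS_range fS_XS undef_values by (intro eta_hat_range) auto
  have \<eta>hat_measurable: "(\<lambda>(w, s, u). \<eta>hat n w s u) \<in> borel_measurable (\<Omega> \<Otimes>\<^sub>M ?N)" for n
    unfolding \<eta>hat_def using fS_range XS ftilde_measurable by (intro measurable_eta_hat fS_measurable) auto
  have \<eta>hat_meas_w: "(\<lambda>w. \<eta>hat n w s u) \<in> borel_measurable \<Omega>" if "s \<in> space \<X>\<^sub>S" "u \<in> space \<X>\<^sub>U" for n s u
    using measurable_compose[OF _ \<eta>hat_measurable[of n], of "\<lambda>w. (w, s, u)" \<Omega>] that by simp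
  have \<eta>hat_meas_su: "(\<lambda>p. \<eta>hat n w (fst p) (snd p)) \<in> borel_measurable ?N" if "w \<in> space \<Omega>" for n w
    using measurable_compose[OF _ \<eta>hat_measurable[of n], of "\<lambda>p. (w, p)" ?N] that by (simp add: split_def)
  \<comment> \<open>Stated for every filter, so that it serves both modes of convergence.\<close>
  have H_lim: "((\<lambda>i. ?H s (a i) (b' i) (t i)) \<longlongrightarrow> b (s, u)) F"
    if "(a \<longlongrightarrow> q) F" "(b' \<longlongrightarrow> m) F" "(t \<longlongrightarrow> \<eta>tilde u) F"
      "fS s * fU u * (1 - q) + (1 - fS s) * (1 - fU u) * q > 0"
    for a b' t and F :: "'i filter" and s u
    unfolding b_def prod.case
    using that q01 e_neq by (intro tendsto_eta_of_averages[OF that(1-3) _ e0_def e1_def]) (auto simp: fU_def)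

  \<comment> \<open>The deviation is taken from \<open>b\<close> and not from \<eta>, because
    \<open>b\<close> has values in [0,1] everywhere; this keeps \<open>?G\<close> in [0,1]
    pointwise.\<close>
  let ?G = "\<lambda>n w p. \<bar>\<eta>hat n w (fst p) (snd p) - b p\<bar>"
  have G_measurable: "(\<lambda>(w, p). ?G n w p) \<in> borel_measurable (\<Omega> \<Otimes>\<^sub>M P_SU)" for n
  proof -
    note [measurable] = \<eta>hat_measurable[of n]
    have "(\<lambda>x. \<bar>(\<lambda>(w, s, u). \<eta>hat n w s u) x - b (snd x)\<bar>) \<in> borel_measurable (\<Omega> \<Otimes>\<^sub>M P_SU)"
      by measurable
    then show ?thesis by (simp add: split_def)
  qed
  have G_range: "?G n w p \<in> {0..1}" if "w \<in> space \<Omega>" "p \<in> space P_SU" for n w p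
    using \<eta>hat_range[OF that(1), of "fst p" n "snd p"] b01[of p] that(2)
    by (auto simp: space_SU space_pair_measure)

  \<comment> \<open>Excess risk of the realised classifier\<close>
  have hhat: "hhat n w s u \<longleftrightarrow> \<eta>hat n w s u > 1/2" for n w s u
    by (simp add: hhat_def \<eta>hat_def h_hat_def)
  have risk_le: "\<bar>risk P (hhat n w) - risk P hstar\<bar> \<le> 2 * (\<integral>p. ?G n w p \<partial>P_SU)" if w: "w \<in> space \<Omega>" for n w
  proof -
    have range: "\<eta>hat n w (fst p) (snd p) \<in> {0..1}" if "p \<in> space ?N" for p
      using that \<eta>hat_range[OF w] by (auto simp: space_pair_measure)
    have "\<bar>risk P (hhat n w) - risk P hstar\<bar> \<le> 2 * (\<integral>p. \<bar>\<eta>hat n w (fst p) (snd p) - (\<lambda>(s, u). \<eta> s u) p\<bar> \<partial>P_SU)"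
      using P.plug_in_excess_risk[OF featSU _ \<eta> \<eta>hat_meas_su[OF w] range]
      by (simp add: risk_def hhat hstar_def P_SU_def)
    also have "(\<integral>p. \<bar>\<eta>hat n w (fst p) (snd p) - (\<lambda>(s, u). \<eta> s u) p\<bar> \<partial>P_SU) = (\<integral>p. ?G n w p \<partial>P_SU)"
    proof (rule integral_cong_AE)
      note [measurable] = \<eta>hat_meas_su[OF w, of n]
      show "(\<lambda>p. \<bar>\<eta>hat n w (fst p) (snd p) - (\<lambda>(s, u). \<eta> s u) p\<bar>) \<in> borel_measurable P_SU"
        "?G n w \<in> borel_measurable P_SU" by measurable
      show "AE p in P_SU. \<bar>\<eta>hat n w (fst p) (snd p) - (\<lambda>(s, u). \<eta> s u) p\<bar> = ?G n w p"
        using \<eta>_eq by eventually_elim simp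
    qed
    finally show ?thesis .
  qed
  have risk_measurable: "(\<lambda>w. risk P (hhat n w)) \<in> borel_measurable \<Omega>" for n
  proof -
    note [measurable] = \<eta>hat_measurable[of n]
    \<comment> \<open>By \<open>misclassification_prob\<close> the risk is an integral over
      \<open>p\<close> of a function jointly measurable in \<open>w\<close> and \<open>p\<close>,
      hence measurable in \<open>w\<close>.\<close>
    have "(\<lambda>w. \<integral>p. (if (\<lambda>(w, s, u). \<eta>hat n w s u) (w, p) > 1/2 then 1 - b p else b p) \<partial>P_SU) \<in> borel_measurable \<Omega>"
      by measurable
    also have "?this \<longleftrightarrow> ?thesis"
    proof (rule measurable_cong)
      fix w assume w: "w \<in> space \<Omega>"
      note [measurable] = \<eta>hat_meas_su[OF w, of n]
      have "Measurable.pred ?N (\<lambda>p. \<eta>hat n w (fst p) (snd p) > 1/2)" by measurable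
      from P.misclassification_prob[OF featSU _ b_version this]
      show "(\<integral>p. (if (\<lambda>(w, s, u). \<eta>hat n w s u) (w, p) > 1/2 then 1 - b p else b p) \<partial>P_SU) = risk P (hhat n w)"
        by (simp add: risk_def hhat P_SU_def split_def)
    qed
    finally show ?thesis .
  qed
  \<comment> \<open>\<open>P_U\<close> is the second marginal of \<open>P_SU\<close>, so a null set
    of values of \<open>X_U\<close> gives a null set of pairs.\<close>
  have AE_U: "AE p in P_SU. Q (snd p)" if "AE u in P_U. Q u" for Q
  proof -
    have eq: "distr P_SU \<X>\<^sub>U snd = P_U"
      unfolding P_U_def P_SU_def by (subst distr_distr) (simp_all add: comp_def)
    have "AE u in distr P_SU \<X>\<^sub>U snd. Q u" unfolding eq by (rule that)
    then show ?thesis by (rule AE_distrD[rotated]) measurable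
  qed
  show ?thesis
  proof (intro conjI impI)

    \<comment> \<open>Convergence in probability\<close>
    assume "AE u in P_U. tendsto_in_prob \<Omega> (\<lambda>n w. ftilde n w u) (\<eta>tilde u)"
    then have "AE p in P_SU. tendsto_in_prob \<Omega> (\<lambda>n w. ftilde n w (snd p)) (\<eta>tilde (snd p))"
      by (rule AE_U)
    with den have lim: "AE p in P_SU. tendsto_in_prob \<Omega> (\<lambda>n w. \<eta>hat n w (fst p) (snd p)) (b p)"
      using AE_space
    proof eventually_elim
      case (elim p)
      obtain s u where p: "p = (s, u)" "s \<in> space \<X>\<^sub>S" "u \<in> space \<X>\<^sub>U"
        using elim(3) by (cases p) (auto simp: space_SU space_pair_measure)
      show ?case
      proof (rule \<Omega>.tendsto_in_prob_continuous3[OF a_lim(1) b_lim(1) elim(2),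
            where h="\<lambda>x. ?H s (fst x) (fst (snd x)) (snd (snd x))"])
        show "(\<lambda>w. \<eta>hat n w (fst p) (snd p)) \<in> borel_measurable \<Omega>" for n
          using p \<eta>hat_meas_w by simp
        show "\<forall>\<^sub>F n in sequentially. \<forall>w\<in>space \<Omega>. \<eta>hat n w (fst p) (snd p) =
            ?H s (fst (?a n w, ?b n w, ftilde n w (snd p))) (fst (snd (?a n w, ?b n w, ftilde n w (snd p))))
              (snd (snd (?a n w, ?b n w, ftilde n w (snd p))))"
          using eventually_gt_at_top[of 0] by eventually_elim (simp add: p \<eta>hat_avg)
        \<comment> \<open>Applying \<open>H_lim\<close> to the coordinate projections along the
          product of neighbourhood filters expresses continuity of \<open>?H s\<close> at the limit
          point.\<close>
        let ?F = "nhds q \<times>\<^sub>F nhds m \<times>\<^sub>F nhds (\<eta>tilde (snd p))"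
        have "filterlim fst (nhds q) ?F" "filterlim (\<lambda>x. fst (snd x)) (nhds m) ?F"
          "filterlim (\<lambda>x. snd (snd x)) (nhds (\<eta>tilde (snd p))) ?F"
          by (auto intro: filterlim_fst filterlim_compose[OF filterlim_fst filterlim_snd] filterlim_compose[OF filterlim_snd filterlim_snd])
        then show "((\<lambda>x. ?H s (fst x) (fst (snd x)) (snd (snd x))) \<longlongrightarrow> b p) ?F"
          using elim(1) unfolding p(1) by (intro H_lim) simp_all
      qed
    qed
    with \<eta>_eq show "AE (s, u) in P_SU. tendsto_in_prob \<Omega> (\<lambda>n w. \<eta>hat n w s u) (\<eta> s u)"
      by eventually_elim auto
    have G_lim: "AE p in P_SU. tendsto_in_prob \<Omega> (\<lambda>n w. ?G n w p) 0"
      using lim by eventually_elim (rule tendsto_in_prob_abs_diff)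
    have "tendsto_in_prob \<Omega> (\<lambda>n w. \<integral>p. ?G n w p \<partial>P_SU) 0"
      by (rule tendsto_in_prob_integral[where G="?G", OF \<Omega>.prob_space_axioms SU.prob_space_axioms G_measurable _ G_lim])
        (rule G_range)
    then show "tendsto_in_prob \<Omega> (\<lambda>n w. risk P (hhat n w)) (risk P hstar)"
      by (rule \<Omega>.tendsto_in_prob_sandwich[OF _ risk_measurable risk_le])
  next

    \<comment> \<open>Almost sure convergence\<close>
    assume "AE u in P_U. AE w in \<Omega>. (\<lambda>n. ftilde n w u) \<longlonglongrightarrow> \<eta>tilde u"
    then have "AE p in P_SU. AE w in \<Omega>. (\<lambda>n. ftilde n w (snd p)) \<longlonglongrightarrow> \<eta>tilde (snd p)"
      by (rule AE_U)
    with den have lim: "AE p in P_SU. AE w in \<Omega>. (\<lambda>n. \<eta>hat n w (fst p) (snd p)) \<longlonglongrightarrow> b p"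
      using AE_space
    proof eventually_elim
      case (elim p)
      obtain s u where p: "p = (s, u)" "s \<in> space \<X>\<^sub>S" "u \<in> space \<X>\<^sub>U"
        using elim(3) by (cases p) (auto simp: space_SU space_pair_measure)
      show ?case
        \<comment> \<open>For a fixed pair, the almost sure events for the estimate and the two
          averages are intersected; the limit is then deterministic along each remaining
          \<open>w\<close>.\<close>
        using elim(2) a_lim(2) b_lim(2) AE_space
      proof eventually_elim
        case (elim w)
        have "(\<lambda>n. ?H s (?a n w) (?b n w) (ftilde n w u)) \<longlonglongrightarrow> b (s, u)"
          using elim \<open>case p of (s, u) \<Rightarrow> _\<close> unfolding p(1) by (intro H_lim) simp_all
        moreover have "\<forall>\<^sub>F n in sequentially. ?H s (?a n w) (?b n w) (ftilde n w u) = \<eta>hat n w s u"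
          using eventually_gt_at_top[of 0] by eventually_elim (simp add: p elim \<eta>hat_avg)
        ultimately show ?case unfolding p(1) fst_conv snd_conv by (rule Lim_transform_eventually)
      qed
    qed
    with \<eta>_eq show "AE (s, u) in P_SU. AE w in \<Omega>. (\<lambda>n. \<eta>hat n w s u) \<longlonglongrightarrow> \<eta> s u"
      by eventually_elim auto
    have G_lim: "AE p in P_SU. AE w in \<Omega>. (\<lambda>n. ?G n w p) \<longlonglongrightarrow> 0"
      using lim
    proof eventually_elim
      case (elim p)
      then show ?case by eventually_elim (simp add: LIM_zero tendsto_rabs_zero)
    qed
    have "AE w in \<Omega>. (\<lambda>n. \<integral>p. ?G n w p \<partial>P_SU) \<longlonglongrightarrow> 0"
      by (rule AE_tendsto_integral[where G="?G", OF \<Omega>.prob_space_axioms SU.prob_space_axioms G_measurable _ G_lim])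
        (rule G_range)
    then show "AE w in \<Omega>. (\<lambda>n. risk P (hhat n w)) \<longlonglongrightarrow> risk P hstar"
      using AE_space
    proof eventually_elim
      case (elim w)
      have "(\<lambda>n. 2 * (\<integral>p. ?G n w p \<partial>P_SU)) \<longlonglongrightarrow> 0"
        using tendsto_mult_right_zero[OF elim(1)] by simp
      \<comment> \<open>The bound \<open>risk_le\<close> holds for every sample point
        \<open>w\<close>, so the null set is the one on which the integrals of \<open>?G\<close>
        fail to converge.\<close>
      then have "(\<lambda>n. risk P (hhat n w) - risk P hstar) \<longlonglongrightarrow> 0"
        by (rule Lim_null_comparison[rotated]) (use risk_le[OF elim(2)] in simp)
      then show ?case by (rule LIM_zero_cancel)
    qed
  qed
qed

end
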